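(* There exist absolute constants $C_1, C_2>0$ such that for all integers $r \geq 3$ and $t \geq r-2$, $$ C_1\left(\frac{4^{t-r}}{\sqrt{t-r+3}} + r\right) \leq f(r,t) \leq C_2\left(\frac{4^{t-r} \min(r,\sqrt{t-r+3})}{\sqrt{t-r+3}} + r\right). $$
   Context: All graphs are finite and simple. A graph $G$ is $K_r$-saturated if it contains no copy of $K_r$ but adding any new edge creates a copy of $K_r$. For integers $r\ge 3$ and $t \ge r-2$, $f(r,t)$ denotes the maximum, over all $K_r$-saturated graphs $G$, of the number of vertices of $G$ of degree at most $t$ that are adjacent to some other vertex of degree at most $t$ (this maximum is finite). *)

theory Defs
  imports Complex_Main "HOL-Library.Ramsey"
begin

definition finite_simple_graph :: "'a set \<Rightarrow> 'a set set \<Rightarrow> bool" where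
  "finite_simple_graph V E \<longleftrightarrow> finite V \<and> E \<subseteq> [V]\<^bsup>2\<^esup>"

definition contains_K :: "nat \<Rightarrow> 'a set \<Rightarrow> 'a set set \<Rightarrow> bool" where
  "contains_K r V E \<longleftrightarrow> (\<exists>K \<in> [V]\<^bsup>r\<^esup>. clique K E)"

definition K_saturated :: "nat \<Rightarrow> 'a set \<Rightarrow> 'a set set \<Rightarrow> bool" where
  "K_saturated r V E \<longleftrightarrow>
     finite_simple_graph V E \<and> \<not> contains_K r V E \<and>
     (\<forall>e \<in> [V]\<^bsup>2\<^esup> - E. contains_K r V (insert e E))"

definition degree :: "'a set set \<Rightarrow> 'a \<Rightarrow> nat" where
  "degree E v = card {e \<in> E. v \<in> e}"

definition paired_low_vertices :: "nat \<Rightarrow> 'a set \<Rightarrow> 'a set set \<Rightarrow> 'a set" where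
  "paired_low_vertices t V E =
     {v \<in> V. degree E v \<le> t \<and> (\<exists>w \<in> V. w \<noteq> v \<and> {v, w} \<in> E \<and> degree E w \<le> t)}"

text \<open>Every finite graph is isomorphic to one whose vertices are natural numbers, and the
  number of vertices counted here is an isomorphism invariant, so it suffices to range over
  graphs with vertices in \<^typ>\<open>nat\<close>.\<close>

definition low_counts :: "nat \<Rightarrow> nat \<Rightarrow> nat set" where
  "low_counts r t =
     {card (paired_low_vertices t V E) | (V :: nat set) E. K_saturated r V E}"

text \<open>\<^const>\<open>Max\<close> is meaningful only on finite nonempty sets; \<^term>\<open>low_counts r t\<close> is never
  empty (for \<open>r \<ge> 3\<close> the one-vertex graph is saturated), so finiteness is what makes
  this the maximum.\<close>

definition low_max :: "nat \<Rightarrow> nat \<Rightarrow> nat" where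
  "low_max r t = Max (low_counts r t)"

end

theory Submission
  imports Defs "HOL-Combinatorics.Permutations" "HOL-Library.Nat_Bijection" "HOL-Real_Asymp.Real_Asymp"
begin

text \<open>
  Put k = r - 3 and s = t - r + 3.

  Lower bound: in the graph where 2m points are joined to the m-subsets containing them and
  complementary m-subsets are joined to each other, all m-subsets are low for t = m + 1; joining a
  graph with a new vertex raises r and t by one.

  Upper bound: let A be the set of high neighbours of a low vertex u, and B the neighbourhood of a
  low neighbour w of u.  No (k+1)-clique lies in A \<inter> B, but for a second such edge u'w' far from uw
  there is one in A \<inter> B' and one in A' \<inter> B.  Call a vertex set L good for (A, B) if the clique
  numbers of A - L and B \<inter> L add up to at most k; then no L is good for both pairs.  There are
  disjoint P and Q with at most 2s elements in total such that at least half of all L containing P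
  and avoiding Q are good.  A uniformly random L yields at most 2 * 4^s pairs.  An initial segment L
  of a random order separates P from Q with probability 1 / C(2s, s) or more; two initial segments
  exclude each other once the clique number allowed in A - L is fixed, which costs a factor k + 1.
  If u has h low neighbours, then A loses h elements and P and Q together have at most 2s - h: this
  exponential gain pays for restricting to edges that are far apart.
\<close>


section \<open>Splitting a pair of sets by a colouring\<close>

text \<open>The obstacle is a trade. Discarding the \<open>h\<close> low neighbours of
  \<open>u\<close> from \<open>A\<close> makes \<open>P\<close> and \<open>Q\<close> smaller, but
  the cliques that separate two pairs must survive in the reduced \<open>A\<close>. They do if no
  common neighbour \<open>z\<close> of \<open>u\<close> and \<open>w'\<close> is low; a low
  \<open>z\<close> would give the walk \<open>u'\<close>, \<open>w'\<close>, \<open>z\<close>,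
  \<open>u\<close>, hence the demand for distance more than three among low vertices. Passing to
  far-apart vertices loses a factor polynomial in \<open>h\<close>, provided that each dropped
  vertex is charged to one whose degree controls all degrees on the way. The weight
  \<open>(3 / 2) ^ h\<close> fits between the two: it beats every polynomial, and it is affordable
  because middle binomial coefficients grow by at least \<open>3 / 2\<close> per step from index one
  on. Only half of all \<open>L\<close> can be asked for: if \<open>A\<close> and \<open>B\<close>
  are disjoint cliques and \<open>k\<close> is positive, no \<open>P\<close> and \<open>Q\<close>
  this small make every \<open>L\<close> good, but of \<open>L\<close> and its image under a
  matching one is good. With fewer than two far-apart vertices there is no second pair; then
  Hajnal's lemma in the neighbourhood of one vertex replaces the set-pair inequalities.\<close>

definition clique_le :: "'a set set \<Rightarrow> 'a set \<Rightarrow> nat \<Rightarrow> bool" where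
  "clique_le E X k \<longleftrightarrow> (\<forall>K\<subseteq>X. clique K E \<longrightarrow> card K \<le> k)"

lemma clique_leD: "clique_le E X k \<Longrightarrow> K \<subseteq> X \<Longrightarrow> clique K E \<Longrightarrow> card K \<le> k"
  by (auto simp: clique_le_def)

lemma clique_le_mono: "clique_le E X k \<Longrightarrow> Y \<subseteq> X \<Longrightarrow> k \<le> l \<Longrightarrow> clique_le E Y l"
  unfolding clique_le_def by (meson order_trans)

lemma clique_le_card: "finite X \<Longrightarrow> clique_le E X (card X)"
  by (simp add: clique_le_def card_mono)

lemma clique_subset: "clique K E \<Longrightarrow> K' \<subseteq> K \<Longrightarrow> clique K' E"
  by (auto simp: clique_def)

lemma clique_le_insert:
  assumes "clique_le E (X - {v}) k"
  shows "clique_le E X (Suc k)"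
  unfolding clique_le_def
proof (intro allI impI)
  fix K assume K: "K \<subseteq> X" "clique K E"
  have "card (K - {v}) \<le> k"
    using assms K clique_subset[of K E "K - {v}"] by (intro clique_leD[of E "X - {v}"]) auto
  then show "card K \<le> Suc k"
    by (cases "v \<in> K") (auto simp: card_Diff_singleton)
qed

text \<open>Hajnal's lemma. A vertex of \<open>\<Inter>F\<close> is adjacent to all other vertices
  of \<open>\<Union>F\<close>, so for a further clique \<open>K\<close> the set
  \<open>K \<inter> \<Union>F \<union> \<Inter>F\<close> is again a clique and has at most
  \<open>k\<close> elements; inclusion-exclusion turns this into the induction step.\<close>

lemma Hajnal_max_cliques:
  assumes "finite F" "F \<noteq> {}"
    and "\<And>K. K \<in> F \<Longrightarrow> finite K \<and> clique K E \<and> card K = k \<and> K \<subseteq> X"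
    and "clique_le E X k"
  shows "2 * k \<le> card (\<Inter>F) + card (\<Union>F)"
  using assms(1-3)
proof (induction F rule: finite_ne_induct)
  case (singleton K)
  then show ?case by simp
next
  case (insert K F)
  let ?I = "\<Inter>F" and ?U = "\<Union>F"
  have K: "finite K" "clique K E" "card K = k" "K \<subseteq> X" using insert.prems by auto
  have F: "finite L" "clique L E" "L \<subseteq> X" if "L \<in> F" for L using insert.prems that by auto
  obtain L where L: "L \<in> F" using insert.hyps by auto
  have finI: "finite ?I" using F(1)[OF L] L by (meson Inf_lower finite_subset)
  have finU: "finite ?U" using insert.hyps F by auto
  have "clique (K \<inter> ?U \<union> ?I) E"
    unfolding clique_def
  proof (intro ballI impI)
    have *: "{x, y} \<in> E" if "x \<in> ?I" "y \<in> ?U" "x \<noteq> y" for x y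
      using that F(2) by (fastforce simp: clique_def)
    have IU: "?I \<subseteq> ?U" using L by auto
    fix v w assume "v \<in> K \<inter> ?U \<union> ?I" "w \<in> K \<inter> ?U \<union> ?I" "v \<noteq> w"
    then consider "v \<in> K" "w \<in> K" | "v \<in> ?I" "w \<in> ?U" | "w \<in> ?I" "v \<in> ?U" using IU by blast
    then show "{v, w} \<in> E"
    proof cases
      case 1
      then show ?thesis using K(2) \<open>v \<noteq> w\<close> by (auto simp: clique_def)
    next
      case 2
      then show ?thesis using * \<open>v \<noteq> w\<close> by blast
    next
      case 3
      then show ?thesis using *[of w v] \<open>v \<noteq> w\<close> by (simp add: insert_commute)
    qed
  qed
  moreover have "K \<inter> ?U \<union> ?I \<subseteq> X" using K(4) F(3)[OF L] L by auto
  ultimately have le: "card (K \<inter> ?U \<union> ?I) \<le> k" using assms(4) clique_leD by metis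
  have I_split: "card ?I = card (?I \<inter> K) + card (?I - K)"
    using finI by (metis Diff_disjoint Int_Diff_Un card_Un_disjoint finite_Diff finite_Int inf_assoc inf_bot_right inf_commute)
  have "K \<inter> ?U \<union> ?I = (K \<inter> ?U) \<union> (?I - K)" using L by auto
  then have "card (K \<inter> ?U \<union> ?I) = card (K \<inter> ?U) + card (?I - K)"
    using K(1) finI by (subst card_Un_disjoint[symmetric]) auto
  moreover have "card (K \<union> ?U) + card (K \<inter> ?U) = k + card ?U"
    using card_Un_Int[OF K(1) finU] K(3) by simp
  ultimately have "card ?I + card ?U \<le> card (?I \<inter> K) + card (K \<union> ?U)"
    using le I_split by linarith
  then show ?case using insert.IH insert.prems by (simp add: Int_commute)
qed

text \<open>The maximum cliques have empty intersection, so in Hajnal's lemma their union alone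
  accounts for \<open>2 * k\<close>.\<close>

lemma two_mult_le_card_if_no_common_vertex:
  assumes "finite X" "clique_le E X k"
    and "\<And>v. v \<in> X \<Longrightarrow> \<exists>K\<subseteq>X - {v}. clique K E \<and> card K = k"
    and "X \<noteq> {}"
  shows "2 * k \<le> card X"
proof -
  let ?F = "{K. K \<subseteq> X \<and> clique K E \<and> card K = k}"
  have fin: "finite ?F" using assms(1) by simp
  obtain v where "v \<in> X" using assms(4) by auto
  then have ne: "?F \<noteq> {}" using assms(3) by blast
  have "\<Inter>?F = {}"
  proof (rule equals0I)
    fix v assume v: "v \<in> \<Inter>?F"
    then have "v \<in> X" using ne by auto
    then show False using assms(3) v by blast
  qed
  moreover have "2 * k \<le> card (\<Inter>?F) + card (\<Union>?F)"
    using fin ne assms(1,2) by (intro Hajnal_max_cliques[of _ E _ X]) (auto intro: finite_subset)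
  moreover have "card (\<Union>?F) \<le> card X" using assms(1) by (intro card_mono) auto
  ultimately show ?thesis by simp
qed

text \<open>The share \<open>a\<close> of the budget is kept explicit because nested sets
  \<open>L\<close> exclude each other only at a common share. Subtraction is truncated, so the
  notion is meant for \<open>a \<le> k\<close>.\<close>

definition splits :: "'a set set \<Rightarrow> 'a set \<Rightarrow> 'a set \<Rightarrow> nat \<Rightarrow> nat \<Rightarrow> 'a set \<Rightarrow> bool" where
  "splits E A B k a L \<longleftrightarrow> clique_le E (A - L) a \<and> clique_le E (B \<inter> L) (k - a)"

text \<open>A single vertex raises only one of the two clique numbers, that of
  \<open>B \<inter> L\<close> or that of \<open>A - L\<close> according to its side, and the extra
  unit of budget goes there.\<close>

lemma splits_insert:
  assumes "\<exists>a\<le>k. splits E (A - {v}) (B - {v}) k a L"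
  shows "\<exists>a\<le>Suc k. splits E A B (Suc k) a L"
proof -
  obtain a where a: "a \<le> k" "clique_le E (A - {v} - L) a" "clique_le E ((B - {v}) \<inter> L) (k - a)"
    using assms by (auto simp: splits_def)
  show ?thesis
  proof (cases "v \<in> L")
    case True
    then have "A - L = A - {v} - L" "B \<inter> L - {v} = (B - {v}) \<inter> L" by auto
    then have "splits E A B (Suc k) a L"
      using a clique_le_insert[of E "B \<inter> L" v "k - a"] by (simp add: splits_def Suc_diff_le)
    then show ?thesis using a(1) by (meson le_SucI)
  next
    case False
    then have "A - L - {v} = A - {v} - L" "B \<inter> L = (B - {v}) \<inter> L" by auto
    then have "splits E A B (Suc k) (Suc a) L"
      using a clique_le_insert[of E "A - L" v a] by (simp add: splits_def)
    then show ?thesis using a(1) by auto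
  qed
qed

text \<open>The involution \<open>\<sigma>\<close> serves counting: it acts injectively on the
  subsets and on the orders of any set containing \<open>A \<union> B\<close>, so that
  "\<open>L\<close> or its image is good" yields at least half of the weight of the event that
  \<open>P\<close> and \<open>Q\<close> are separated.\<close>

definition forcing :: "'a set set \<Rightarrow> 'a set \<Rightarrow> 'a set \<Rightarrow> nat \<Rightarrow> 'a set \<Rightarrow> 'a set \<Rightarrow> ('a \<Rightarrow> 'a) \<Rightarrow> bool" where
  "forcing E A B k P Q \<sigma> \<longleftrightarrow>
     P \<subseteq> A \<and> Q \<subseteq> B \<and> P \<inter> Q = {} \<and> card P + card Q + 2 * k \<le> card A + card B \<and>
     \<sigma> permutes (A \<union> B) \<and> (\<forall>x. \<sigma> (\<sigma> x) = x) \<and>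
     (\<forall>L. P \<subseteq> L \<and> Q \<inter> L = {} \<longrightarrow>
        (\<exists>a\<le>k. splits E A B k a L) \<or> (\<exists>a\<le>k. splits E A B k a (\<sigma> ` L)))"

text \<open>Induction on the budget \<open>k\<close>. Either deleting some common vertex lowers the
  clique bound of \<open>A \<inter> B\<close>, or every common vertex is avoided by a maximum
  clique, or there is no common vertex; only the last case creates a nontrivial
  \<open>\<sigma>\<close>.\<close>

lemma exists_forcing:
  assumes "finite A" "finite B" "clique_le E (A \<inter> B) k" "k \<le> card A" "k \<le> card B"
  shows "\<exists>P Q \<sigma>. forcing E A B k P Q \<sigma>"
  using assms
proof (induction k arbitrary: A B)
  case 0
  have "card {v} \<le> 0" if "v \<in> A \<inter> B" for v
    using that 0(3) by (intro clique_leD[of E "A \<inter> B" 0]) (auto simp: clique_def)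
  then have "A \<inter> B = {}" by fastforce
  have "splits E A B 0 0 L" if "A \<subseteq> L" "B \<inter> L = {}" for L
  proof -
    have "A - L = {}" using that by auto
    then show ?thesis unfolding splits_def using that by (simp only: clique_le_def) auto
  qed
  then have "forcing E A B 0 A B id"
    using \<open>A \<inter> B = {}\<close> by (simp add: forcing_def permutes_def)
  then show ?case by blast
next
  case (Suc k)
  consider (disj) "A \<inter> B = {}"
    | (rem) v where "v \<in> A \<inter> B" "clique_le E (A \<inter> B - {v}) k"
    | (big) "A \<inter> B \<noteq> {}" "\<And>v. v \<in> A \<inter> B \<Longrightarrow> \<not> clique_le E (A \<inter> B - {v}) k"
    by blast
  then show ?case
  proof cases
    case disj
    \<comment> \<open>\<open>Suc k\<close> elements stay free on each side, and
      \<open>\<sigma>\<close> exchanges them along a matching. The bounds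
      \<open>card (A0 - L) + card (B0 \<inter> L)\<close> for \<open>L\<close> and for its image add
      up to \<open>2 * Suc k\<close>, so one of them is within the budget.\<close>
    obtain A0 where A0: "A0 \<subseteq> A" "card A0 = Suc k" "finite A0"
      using Suc.prems by (meson obtain_subset_with_card_n)
    obtain B0 where B0: "B0 \<subseteq> B" "card B0 = Suc k" "finite B0"
      using Suc.prems by (meson obtain_subset_with_card_n)
    obtain f where f: "bij_betw f A0 B0"
      using finite_same_card_bij[OF A0(3) B0(3)] A0(2) B0(2) by auto
    define g where "g = the_inv_into A0 f"
    have dj: "A0 \<inter> B0 = {}" using A0 B0 disj by auto
    have fg: "\<And>x. x \<in> A0 \<Longrightarrow> f x \<in> B0 \<and> g (f x) = x" "\<And>y. y \<in> B0 \<Longrightarrow> g y \<in> A0 \<and> f (g y) = y"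
      using f unfolding g_def
      by (auto simp: bij_betw_def the_inv_into_f_f f_the_inv_into_f the_inv_into_into)
    define \<sigma> where "\<sigma> x = (if x \<in> A0 then f x else if x \<in> B0 then g x else x)" for x
    have inv: "\<sigma> (\<sigma> x) = x" for x using fg dj by (auto simp: \<sigma>_def)
    have out: "\<sigma> x = x" if "x \<notin> A \<union> B" for x using that A0 B0 by (auto simp: \<sigma>_def)
    have perm: "\<sigma> permutes (A \<union> B)"
      unfolding permutes_def using out inv by metis
    have mem: "x \<in> \<sigma> ` L \<longleftrightarrow> \<sigma> x \<in> L" for x L by (metis image_iff inv)
    have "(\<exists>a\<le>Suc k. splits E A B (Suc k) a L) \<or> (\<exists>a\<le>Suc k. splits E A B (Suc k) a (\<sigma> ` L))"
      if L: "A - A0 \<subseteq> L" "(B - B0) \<inter> L = {}" for L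
    proof -
      have *: "\<exists>a\<le>Suc k. splits E A B (Suc k) a M"
        if M: "A - A0 \<subseteq> M" "(B - B0) \<inter> M = {}" "card (A0 - M) + card (B0 \<inter> M) \<le> Suc k" for M
      proof -
        have "A - M = A0 - M" "B \<inter> M = B0 \<inter> M" using M A0 B0 by auto
        then have "splits E A B (Suc k) (card (A0 - M)) M"
          using M(3) clique_le_card[of "A0 - M" E] clique_le_card[of "B0 \<inter> M" E] A0(3) B0(3)
          by (auto simp: splits_def intro: clique_le_mono)
        then show ?thesis using M(3) by (metis add_leE)
      qed
      have fixed: "\<sigma> x = x" if "x \<in> (A - A0) \<union> (B - B0)" for x
        using that disj A0 B0 by (auto simp: \<sigma>_def)
      have \<sigma>A: "\<sigma> x = f x" if "x \<in> A0" for x using that by (simp add: \<sigma>_def)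
      have \<sigma>B: "\<sigma> y = g y" if "y \<in> B0" for y using that dj by (auto simp: \<sigma>_def)
      have "bij_betw f (A0 - \<sigma> ` L) (B0 - L)"
        by (rule bij_betw_byWitness[where f' = g], (simp add: fg; fail)+)
          (rule image_subsetI, (erule DiffE | erule IntE), simp add: fg mem \<sigma>A \<sigma>B)+
      then have c1: "card (A0 - \<sigma> ` L) = card (B0 - L)" by (rule bij_betw_same_card)
      have "bij_betw f (A0 \<inter> L) (B0 \<inter> \<sigma> ` L)"
        by (rule bij_betw_byWitness[where f' = g], (simp add: fg; fail)+)
          (rule image_subsetI, (erule DiffE | erule IntE), simp add: fg mem \<sigma>A \<sigma>B)+
      then have c2: "card (A0 \<inter> L) = card (B0 \<inter> \<sigma> ` L)" by (rule bij_betw_same_card)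
      have c3: "card (A0 - L) + card (A0 \<inter> L) = Suc k" "card (B0 - L) + card (B0 \<inter> L) = Suc k"
        using card_Diff_subset_Int[of A0 L] card_Diff_subset_Int[of B0 L] A0 B0
          card_mono[of A0 "A0 \<inter> L"] card_mono[of B0 "B0 \<inter> L"] by auto
      show ?thesis
      proof (cases "card (A0 - L) + card (B0 \<inter> L) \<le> Suc k")
        case True
        then show ?thesis using * L by blast
      next
        case False
        then have "card (A0 - \<sigma> ` L) + card (B0 \<inter> \<sigma> ` L) \<le> Suc k" using c1 c2 c3 by linarith
        moreover have "x \<in> \<sigma> ` L" if "x \<in> A - A0" for x using L(1) fixed mem that by (metis UnI1 subsetD)
        then have "A - A0 \<subseteq> \<sigma> ` L" by blast
        moreover have "x \<notin> \<sigma> ` L" if "x \<in> B - B0" for x using L(2) fixed mem that by (metis UnI2 disjoint_iff)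
        then have "(B - B0) \<inter> \<sigma> ` L = {}" by blast
        ultimately show ?thesis using * by blast
      qed
    qed
    moreover have "card (A - A0) + card (B - B0) + 2 * Suc k \<le> card A + card B"
      using A0 B0 Suc.prems by (simp add: card_Diff_subset)
    moreover have "(A - A0) \<inter> (B - B0) = {}" using disj by blast
    ultimately have "forcing E A B (Suc k) (A - A0) (B - B0) \<sigma>"
      unfolding forcing_def using perm inv by simp
    then show ?thesis by blast
  next
    case (rem v) \<comment> \<open>\<open>v\<close> may go to either side, at the cost of one in the budget \<open>k\<close>\<close>
    have "clique_le E ((A - {v}) \<inter> (B - {v})) k"
      using rem(2) by (rule clique_le_mono) auto
    moreover have c: "card A = Suc (card (A - {v}))" "card B = Suc (card (B - {v}))"
      using rem(1) Suc.prems(1,2) by (metis IntD1 card_Suc_Diff1, metis IntD2 card_Suc_Diff1)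
    ultimately obtain P Q \<sigma> where H: "forcing E (A - {v}) (B - {v}) k P Q \<sigma>"
      using Suc.IH[of "A - {v}" "B - {v}"] Suc.prems by auto
    have "\<sigma> permutes (A \<union> B)" using H unfolding forcing_def by (elim conjE permutes_subset) auto
    moreover have "(\<exists>a\<le>Suc k. splits E A B (Suc k) a L) \<or> (\<exists>a\<le>Suc k. splits E A B (Suc k) a (\<sigma> ` L))"
      if "P \<subseteq> L \<and> Q \<inter> L = {}" for L
    proof -
      have "(\<exists>a\<le>k. splits E (A - {v}) (B - {v}) k a L) \<or> (\<exists>a\<le>k. splits E (A - {v}) (B - {v}) k a (\<sigma> ` L))"
        using H that unfolding forcing_def by metis
      then show ?thesis using splits_insert by metis
    qed
    moreover have "P \<subseteq> A" "Q \<subseteq> B" "P \<inter> Q = {}" "card P + card Q + 2 * Suc k \<le> card A + card B"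
      "\<forall>x. \<sigma> (\<sigma> x) = x" using H c by (auto simp: forcing_def)
    ultimately have "forcing E A B (Suc k) P Q \<sigma>" unfolding forcing_def by metis
    then show ?thesis by blast
  next
    case big \<comment> \<open>by Hajnal's lemma so much of \<open>B\<close> lies in \<open>A\<close> that all of \<open>A\<close> can be forced into \<open>L\<close>\<close>
    have "\<exists>K\<subseteq>A \<inter> B - {v}. clique K E \<and> card K = Suc k" if v: "v \<in> A \<inter> B" for v
    proof -
      obtain K where K: "K \<subseteq> A \<inter> B - {v}" "clique K E" "\<not> card K \<le> k"
        using big(2)[OF v] by (auto simp: clique_le_def)
      then have "card K \<le> Suc k" using Suc.prems(3) by (intro clique_leD[of E "A \<inter> B"]) auto
      then show ?thesis using K by (intro exI[of _ K]) auto
    qed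
    then have le: "2 * Suc k \<le> card (A \<inter> B)"
      using Suc.prems big(1) by (intro two_mult_le_card_if_no_common_vertex[of _ E]) auto
    have "card (B - A) = card B - card (A \<inter> B)"
      using Suc.prems by (simp add: card_Diff_subset_Int Int_commute)
    moreover have "card (A \<inter> B) \<le> card B" using Suc.prems by (simp add: card_mono)
    ultimately have "card A + card (B - A) + 2 * Suc k \<le> card A + card B" using le by linarith
    moreover have "splits E A B (Suc k) 0 L" if "A \<subseteq> L \<and> (B - A) \<inter> L = {}" for L
    proof -
      have eq: "A - L = {}" using that by auto
      have "B \<inter> L \<subseteq> A \<inter> B" using that by auto
      then have "clique_le E (B \<inter> L) (Suc k - 0)" using clique_le_mono[OF Suc.prems(3)] by simp
      moreover have "clique_le E {} 0" by (simp add: clique_le_def)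
      ultimately show ?thesis unfolding splits_def eq by blast
    qed
    ultimately have "forcing E A B (Suc k) A (B - A) id"
      unfolding forcing_def by (auto simp: permutes_def)
    then show ?thesis by blast
  qed
qed

section \<open>Set-pair inequalities\<close>

text \<open>\<open>Q\<close> is cut along \<open>L\<close>, and the part inside lies in
  \<open>B' \<inter> L'\<close> since \<open>L \<subseteq> L'\<close>. For
  \<open>a' \<le> k\<close>, a clique of size \<open>k + 1\<close> thus forces
  \<open>a' < a\<close>.\<close>

lemma splits_clique_bound:
  assumes "splits E A B k a L" "splits E A' B' k a' L'" "L \<subseteq> L'"
    and "Q \<subseteq> A \<inter> B'" "clique Q E" "finite Q"
  shows "card Q \<le> a + (k - a')"
proof -
  have "card (Q - L) \<le> a"
    using assms clique_subset[of Q E "Q - L"] by (intro clique_leD[of E "A - L"]) (auto simp: splits_def)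
  moreover have "card (Q \<inter> L) \<le> k - a'"
    using assms clique_subset[of Q E "Q \<inter> L"] by (intro clique_leD[of E "B' \<inter> L'"]) (auto simp: splits_def)
  moreover have "card Q = card (Q - L) + card (Q \<inter> L)"
    using card_Int_Diff[OF assms(6), of L] by simp
  ultimately show ?thesis by simp
qed

section \<open>Counting subsets and orders\<close>

lemma card_preimage_le:
  assumes "inj_on f X" "finite G"
  shows "card {x \<in> X. f x \<in> G} \<le> card G"
  by (rule card_inj_on_le[of f]) (use assms in \<open>auto simp: inj_on_def\<close>)

lemma card_le_one_if_unique:
  assumes "finite X" "\<And>x y. x \<in> X \<Longrightarrow> y \<in> X \<Longrightarrow> P x \<Longrightarrow> P y \<Longrightarrow> x = y"
  shows "card {x \<in> X. P x} \<le> 1"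
  using assms by (auto simp: card_le_Suc0_iff_eq)

lemma card_subsets_between:
  assumes "finite V" "P \<subseteq> V" "Q \<subseteq> V" "P \<inter> Q = {}"
  shows "2 ^ card V = 2 ^ (card P + card Q) * card {L. L \<subseteq> V \<and> P \<subseteq> L \<and> Q \<inter> L = {}}"
proof -
  have "bij_betw (\<lambda>M. P \<union> M) (Pow (V - P - Q)) {L. L \<subseteq> V \<and> P \<subseteq> L \<and> Q \<inter> L = {}}"
    using assms by (intro bij_betw_byWitness[where f' = "\<lambda>L. L - P"]) auto
  then have "card {L. L \<subseteq> V \<and> P \<subseteq> L \<and> Q \<inter> L = {}} = 2 ^ card (V - P - Q)"
    using assms(1) by (simp add: bij_betw_same_card[symmetric] card_Pow)
  moreover have "card V = card P + card Q + card (V - P - Q)"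
  proof -
    have "V \<inter> P = P" "(V - P) \<inter> Q = Q" using assms by blast+
    then show ?thesis using card_Int_Diff[of V P] card_Int_Diff[of "V - P" Q] assms(1) by simp
  qed
  ultimately show ?thesis by (simp add: power_add)
qed

lemma obtain_initial_subset:
  fixes ord :: "'a \<Rightarrow> 'b::linorder"
  assumes "finite X" "inj_on ord X" "n \<le> card X"
  obtains S where "S \<subseteq> X" "card S = n" "\<And>x y. x \<in> S \<Longrightarrow> y \<in> X - S \<Longrightarrow> ord x < ord y"
  using assms(3)
proof (induction n arbitrary: thesis)
  case 0
  then show ?case by force
next
  case (Suc n)
  then obtain S where S: "S \<subseteq> X" "card S = n" "\<And>x y. x \<in> S \<Longrightarrow> y \<in> X - S \<Longrightarrow> ord x < ord y"
    by (metis Suc_leD)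
  have "X - S \<noteq> {}" using S Suc.prems by (metis Diff_eq_empty_iff Suc_n_not_le_n card_mono assms(1) finite_subset subset_antisym)
  then obtain m where m: "m \<in> X - S" "\<And>y. y \<in> X - S \<Longrightarrow> ord m \<le> ord y"
    using assms(1) arg_min_if_finite[of "X - S" ord] by (metis finite_Diff linorder_not_less)
  have "ord x < ord y" if "x \<in> insert m S" "y \<in> X - insert m S" for x y
    using that m S assms(2) by (metis Diff_iff inj_onD insert_iff order_le_imp_less_or_eq)
  moreover have "card (insert m S) = Suc n" using m S assms(1) by (metis DiffD2 card_insert_disjoint finite_subset)
  ultimately show ?case using Suc.prems(1)[of "insert m S"] m S by blast
qed

text \<open>An order on \<open>V\<close> is encoded by a permutation whose values are compared. The
  \<open>card P\<close> smallest elements of \<open>P \<union> Q\<close> form one of binomially many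
  sets \<open>S\<close>, and relabelling shows that no \<open>S\<close> is more frequent than
  \<open>P\<close> itself.\<close>

lemma card_permutations_separating:
  fixes V :: "'a::linorder set"
  assumes V: "finite V" and PQ: "P \<subseteq> V" "Q \<subseteq> V" "P \<inter> Q = {}"
  shows "card {p. p permutes V} \<le>
    ((card P + card Q) choose card P) * card {p. p permutes V \<and> (\<forall>x\<in>P. \<forall>y\<in>Q. p x < p y)}"
proof -
  let ?X = "P \<union> Q"
  let ?O = "\<lambda>S. {p. p permutes V \<and> (\<forall>x\<in>S. \<forall>y\<in>?X - S. p x < p y)}"
  let ?F = "{S. S \<subseteq> ?X \<and> card S = card P}"
  have fin: "finite ?X" "finite P" "finite Q" using V PQ by (auto intro: finite_subset)
  have finp: "finite {p. p permutes V}" using V by (simp add: finite_permutations)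
  have "{p. p permutes V} \<subseteq> (\<Union>S\<in>?F. ?O S)"
  proof
    fix p assume "p \<in> {p. p permutes V}"
    then have p: "p permutes V" by simp
    obtain S where "S \<subseteq> ?X" "card S = card P" "\<And>x y. x \<in> S \<Longrightarrow> y \<in> ?X - S \<Longrightarrow> p x < p y"
      using obtain_initial_subset[of ?X p "card P"] fin permutes_inj_on[OF p]
      by (metis card_mono sup_ge1)
    then show "p \<in> (\<Union>S\<in>?F. ?O S)" using p by blast
  qed
  then have "card {p. p permutes V} \<le> card (\<Union>S\<in>?F. ?O S)"
    by (rule card_mono[rotated]) (auto intro: finite_subset[OF _ finp] simp: fin)
  also have "\<dots> \<le> (\<Sum>S\<in>?F. card (?O S))" using fin by (intro card_UN_le) auto
  also have "\<dots> \<le> (\<Sum>S\<in>?F. card (?O P))"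
  proof (rule sum_mono)
    fix S assume "S \<in> ?F"
    then have S: "S \<subseteq> ?X" "card S = card P" by auto
    have finS: "finite S" using S fin finite_subset by blast
    obtain f where f: "bij_betw f P S" using finite_same_card_bij[OF fin(2) finS] S by auto
    have "card (?X - S) = card Q"
      using S fin finS PQ by (simp add: card_Diff_subset card_Un_disjoint)
    then obtain g where g: "bij_betw g Q (?X - S)" using finite_same_card_bij[of Q "?X - S"] fin by auto
    \<comment> \<open>\<open>\<pi>\<close> moves \<open>P\<close> onto \<open>S\<close> and
      \<open>Q\<close> onto the rest, so \<open>p \<circ> \<pi>\<close> puts \<open>P\<close> before
      \<open>Q\<close> whenever \<open>p\<close> puts \<open>S\<close> first.\<close>
    define \<pi> where "\<pi> x = (if x \<in> P then f x else if x \<in> Q then g x else x)" for x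
    have bP: "bij_betw \<pi> P S" using f by (rule iffD1[OF bij_betw_cong, rotated]) (simp add: \<pi>_def)
    have bQ: "bij_betw \<pi> Q (?X - S)" using g PQ by (intro iffD1[OF bij_betw_cong g]) (auto simp: \<pi>_def)
    have "bij_betw \<pi> (P \<union> Q) (S \<union> (?X - S))" using bP bQ by (rule bij_betw_combine) auto
    then have "bij_betw \<pi> ?X ?X" using S(1) by (simp add: Un_absorb1)
    then have "\<pi> permutes ?X" by (rule bij_imp_permutes) (auto simp: \<pi>_def)
    then have \<pi>: "\<pi> permutes V" using PQ by (meson Un_subset_iff permutes_subset)
    have "inj_on (\<lambda>p. p \<circ> \<pi>) (?O S)"
      using permutes_surj[OF \<pi>] by (intro inj_onI) (metis comp_surj fun.inj_map_strong surj_fun_eq)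
    moreover have "(\<lambda>p. p \<circ> \<pi>) ` ?O S \<subseteq> ?O P"
    proof (clarsimp, intro conjI ballI)
      fix p assume p: "p permutes V" "\<forall>x\<in>S. \<forall>y\<in>?X - S. p x < p y"
      show "p \<circ> \<pi> permutes V" using permutes_compose[OF \<pi> p(1)] .
      fix x y assume "x \<in> P" "y \<in> P \<union> Q - P"
      then have "\<pi> x \<in> S" "\<pi> y \<in> ?X - S" using bij_betwE[OF bP] bij_betwE[OF bQ] by auto
      then show "p (\<pi> x) < p (\<pi> y)" using p(2) by blast
    qed
    ultimately show "card (?O S) \<le> card (?O P)"
      by (rule card_inj_on_le) (auto intro: finite_subset[OF _ finp])
  qed
  also have "\<dots> = (card ?X choose card P) * card (?O P)"
    using n_subsets[OF fin(1), of "card P"] by simp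
  also have "card ?X = card P + card Q" using fin PQ by (simp add: card_Un_disjoint)
  also have "?X - P = Q" using PQ by auto
  finally show ?thesis .
qed

definition initial_segment :: "('a \<Rightarrow> 'b::linorder) \<Rightarrow> 'a set \<Rightarrow> 'a set \<Rightarrow> bool" where
  "initial_segment ord V L \<longleftrightarrow> L \<subseteq> V \<and> (\<forall>x\<in>L. \<forall>y\<in>V. ord y \<le> ord x \<longrightarrow> y \<in> L)"

lemma initial_segment_total:
  assumes "initial_segment ord V L" "initial_segment ord V L'"
  shows "L \<subseteq> L' \<or> L' \<subseteq> L"
proof (rule ccontr)
  assume "\<not> ?thesis"
  then obtain x y where "x \<in> L" "x \<notin> L'" "y \<in> L'" "y \<notin> L" by blast
  then show False using assms unfolding initial_segment_def by (meson linear subsetD)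
qed

text \<open>Double counting with a uniform point of \<open>X\<close>: each \<open>F i\<close> is hit
  with probability at least \<open>1 / c i\<close>, and at most \<open>n\<close> of them at once.
  Random subsets use \<open>n = 1\<close>, random orders \<open>n = k + 1\<close>.\<close>

lemma sum_bound_if_disjoint:
  assumes "finite I" "finite X" "\<And>i. i \<in> I \<Longrightarrow> F i \<subseteq> X \<and> real (card X) \<le> c i * real (card (F i)) \<and> c i > 0"
    and "\<And>x. x \<in> X \<Longrightarrow> card {i \<in> I. x \<in> F i} \<le> n" and "X \<noteq> {}"
  shows "(\<Sum>i\<in>I. 1 / c i) \<le> real n"
proof -
  have pos: "real (card X) > 0" using assms(2,5) by (simp add: card_gt_0_iff)
  have fin: "finite (F i)" if "i \<in> I" for i using assms(2,3) that finite_subset by blast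
  have "(\<Sum>i\<in>I. 1 / c i) * real (card X) = (\<Sum>i\<in>I. real (card X) / c i)"
    by (simp add: sum_distrib_right)
  also have "\<dots> \<le> (\<Sum>i\<in>I. real (card (F i)))"
    using assms(3) by (intro sum_mono) (auto simp: field_simps)
  also have "\<dots> = (\<Sum>i\<in>I. \<Sum>x\<in>X. if x \<in> F i then 1 else 0)"
    using assms(2,3) by (intro sum.cong refl) (simp add: sum.If_cases Int_absorb1 inf.commute)
  also have "\<dots> = (\<Sum>x\<in>X. \<Sum>i\<in>I. if x \<in> F i then 1 else 0)" by (rule sum.swap)
  also have "\<dots> = (\<Sum>x\<in>X. real (card {i \<in> I. x \<in> F i}))"
    using assms(1) by (intro sum.cong refl) (simp add: sum.If_cases Int_def)
  also have "\<dots> \<le> (\<Sum>x\<in>X. real n)" using assms(4) by (intro sum_mono) simp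
  finally show ?thesis using pos by (simp add: mult.commute)
qed

text \<open>A clique version of the Bollobas set-pair inequality, under two measures: uniform
  subsets and uniform orders. Only the sum \<open>p i + q i\<close> is controlled, since
  \<open>P\<close> may be all of \<open>A\<close> while only \<open>Q\<close> shrinks; the later use
  therefore passes to the middle binomial coefficient.\<close>

lemma set_pair_inequalities:
  fixes V :: "'a::linorder set"
  assumes I: "finite I" and V: "finite V" "\<And>i. i \<in> I \<Longrightarrow> A i \<subseteq> V \<and> B i \<subseteq> V"
    and diag: "\<And>i. i \<in> I \<Longrightarrow> clique_le E (A i \<inter> B i) k \<and> k \<le> card (A i) \<and> k \<le> card (B i)"
    and off: "\<And>i j. i \<in> I \<Longrightarrow> j \<in> I \<Longrightarrow> i \<noteq> j \<Longrightarrow> \<exists>Q\<subseteq>A i \<inter> B j. clique Q E \<and> card Q = Suc k"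
  shows "\<exists>p q :: 'i \<Rightarrow> nat. (\<forall>i\<in>I. p i + q i + 2 * k \<le> card (A i) + card (B i)) \<and>
    (\<Sum>i\<in>I. 1 / 2 ^ (p i + q i)) \<le> (2::real) \<and>
    (\<Sum>i\<in>I. 1 / real ((p i + q i) choose p i)) \<le> 2 * (real k + 1)"
proof -
  have "finite (A i)" "finite (B i)" if "i \<in> I" for i
    using V that by (metis finite_subset)+
  then have "\<forall>i\<in>I. \<exists>P Q \<sigma>. forcing E (A i) (B i) k P Q \<sigma>"
    using diag by (intro ballI exists_forcing) auto
  then obtain P Q \<sigma> where F: "\<And>i. i \<in> I \<Longrightarrow> forcing E (A i) (B i) k (P i) (Q i) (\<sigma> i)"
    by metis
  have PQ: "P i \<subseteq> A i \<and> Q i \<subseteq> B i \<and> P i \<inter> Q i = {}"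
    and card_PQ: "card (P i) + card (Q i) + 2 * k \<le> card (A i) + card (B i)"
    and \<sigma>: "\<sigma> i permutes (A i \<union> B i)" "\<And>x. \<sigma> i (\<sigma> i x) = x"
    and good: "\<And>L. P i \<subseteq> L \<Longrightarrow> Q i \<inter> L = {} \<Longrightarrow>
      (\<exists>a\<le>k. splits E (A i) (B i) k a L) \<or> (\<exists>a\<le>k. splits E (A i) (B i) k a (\<sigma> i ` L))"
    if "i \<in> I" for i
    using F[OF that] unfolding forcing_def by blast+
  have PQV: "P i \<subseteq> V" "Q i \<subseteq> V" if "i \<in> I" for i using PQ V(2) that by blast+
  have \<sigma>V: "\<sigma> i permutes V" if "i \<in> I" for i
    using \<sigma>(1)[OF that] V(2)[OF that] by (meson Un_subset_iff permutes_subset)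
  have excl: False if H: "i \<in> I" "j \<in> I" "i \<noteq> j" "a \<le> k" "splits E (A i) (B i) k a L" "splits E (A j) (B j) k a L'" "L \<subseteq> L'"
    for i j a L L'
  proof -
    obtain K where "K \<subseteq> A i \<inter> B j" "clique K E" "card K = Suc k" using off[OF H(1-3)] by blast
    then show False
      using splits_clique_bound[OF H(5-7), of K] H(4) by (simp add: card_ge_0_finite)
  qed
  have coins: "(\<Sum>i\<in>I. 1 / (2 * 2 ^ (card (P i) + card (Q i)))) \<le> real 1"
  proof (rule sum_bound_if_disjoint[OF I, where X = "Pow V"
        and F = "\<lambda>i. {L \<in> Pow V. \<exists>a\<le>k. splits E (A i) (B i) k a L}"])
    show "finite (Pow V)" "Pow V \<noteq> {}" using V by auto
  next
    fix i assume i: "i \<in> I"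
    let ?G = "{L \<in> Pow V. \<exists>a\<le>k. splits E (A i) (B i) k a L}"
    let ?X = "{L. L \<subseteq> V \<and> P i \<subseteq> L \<and> Q i \<inter> L = {}}"
    have finG: "finite ?G" using V(1) by simp
    have inj: "inj (image (\<sigma> i))" using permutes_inj[OF \<sigma>V[OF i]] by (metis injI inj_image_eq_iff)
    \<comment> \<open>An admissible \<open>L\<close> that is not good has a good image, so
      \<open>?X\<close> is covered by the good sets and their preimages; this is the factor
      two.\<close>
    have "?X \<subseteq> ?G \<union> {L \<in> Pow V. \<sigma> i ` L \<in> ?G}"
    proof
      fix L assume L: "L \<in> ?X"
      then have "\<sigma> i ` L \<subseteq> V" using permutes_image[OF \<sigma>V[OF i]] by blast
      then show "L \<in> ?G \<union> {L \<in> Pow V. \<sigma> i ` L \<in> ?G}" using L good[OF i, of L] by blast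
    qed
    then have "card ?X \<le> card (?G \<union> {L \<in> Pow V. \<sigma> i ` L \<in> ?G})" using V(1) by (intro card_mono) auto
    also have "\<dots> \<le> card ?G + card {L \<in> Pow V. \<sigma> i ` L \<in> ?G}" by (rule card_Un_le)
    also have "card {L \<in> Pow V. \<sigma> i ` L \<in> ?G} \<le> card ?G"
      using inj finG by (intro card_preimage_le) (rule inj_on_subset, auto)
    finally have "card ?X \<le> 2 * card ?G" by simp
    then have "(2::nat) ^ card V \<le> 2 ^ (card (P i) + card (Q i)) * (2 * card ?G)"
      using card_subsets_between[OF V(1) PQV[OF i]] PQ[OF i] by simp
    then have "card (Pow V) \<le> 2 * 2 ^ (card (P i) + card (Q i)) * card ?G"
      using V(1) by (simp add: card_Pow)
    then have "real (card (Pow V)) \<le> real (2 * 2 ^ (card (P i) + card (Q i)) * card ?G)"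
      by (simp only: of_nat_le_iff)
    then show "?G \<subseteq> Pow V \<and> real (card (Pow V)) \<le> 2 * 2 ^ (card (P i) + card (Q i)) * real (card ?G)
        \<and> (0::real) < 2 * 2 ^ (card (P i) + card (Q i))" by auto
  next
    fix L assume "L \<in> Pow V"
    have "i = j" if ij: "i \<in> I" "j \<in> I" "\<exists>a\<le>k. splits E (A i) (B i) k a L" "\<exists>a\<le>k. splits E (A j) (B j) k a L" for i j
    \<comment> \<open>With the same \<open>L\<close> for both indices, the two cliques give
      \<open>b < a\<close> and \<open>a < b\<close>, so the shares need not agree.\<close>
    proof (rule ccontr)
      assume "i \<noteq> j"
      obtain a b where ab: "a \<le> k" "splits E (A i) (B i) k a L" "b \<le> k" "splits E (A j) (B j) k b L"
        using ij by auto
      obtain K where K: "K \<subseteq> A i \<inter> B j" "clique K E" "card K = Suc k" using off[OF ij(1,2) \<open>i \<noteq> j\<close>] by blast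
      obtain K' where K': "K' \<subseteq> A j \<inter> B i" "clique K' E" "card K' = Suc k"
        using off[OF ij(2,1)] \<open>i \<noteq> j\<close> by blast
      have "Suc k \<le> a + (k - b)"
        using splits_clique_bound[OF ab(2,4) subset_refl K(1,2)] K(3) by (simp add: card_ge_0_finite)
      moreover have "Suc k \<le> b + (k - a)"
        using splits_clique_bound[OF ab(4,2) subset_refl K'(1,2)] K'(3) by (simp add: card_ge_0_finite)
      ultimately show False using ab by linarith
    qed
    then show "card {i \<in> I. L \<in> {L \<in> Pow V. \<exists>a\<le>k. splits E (A i) (B i) k a L}} \<le> 1"
      using I by (intro card_le_one_if_unique) auto
  qed
  let ?S = "{p. p permutes V}"
  have finS: "finite ?S" using V by (simp add: finite_permutations)
  let ?F = "\<lambda>i a. {p \<in> ?S. \<exists>L. initial_segment p V L \<and> splits E (A i) (B i) k a L}"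
  have orders: "(\<Sum>i\<in>I. 1 / (2 * real ((card (P i) + card (Q i)) choose card (P i)))) \<le> real (Suc k)"
  proof (rule sum_bound_if_disjoint[OF I finS, where F = "\<lambda>i. \<Union>a\<le>k. ?F i a"])
    show "?S \<noteq> {}" using permutes_id by blast
  next
    fix i assume i: "i \<in> I"
    let ?G = "\<Union>a\<le>k. ?F i a"
    let ?X = "{p. p permutes V \<and> (\<forall>x\<in>P i. \<forall>y\<in>Q i. p x < p y)}"
    have finG: "finite ?G" by (rule finite_subset[OF _ finS]) auto
    have "?X \<subseteq> ?G \<union> {p \<in> ?S. p \<circ> \<sigma> i \<in> ?G}"
    proof
      fix p assume "p \<in> ?X"
      then have p: "p permutes V" "\<And>x y. x \<in> P i \<Longrightarrow> y \<in> Q i \<Longrightarrow> p x < p y" by auto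
      \<comment> \<open>The smallest initial segment containing \<open>P i\<close>; it misses
        \<open>Q i\<close> because the order puts all of \<open>P i\<close> first.\<close>
      define L where "L = {v \<in> V. \<exists>x\<in>P i. p v \<le> p x}"
      have L: "P i \<subseteq> L" "Q i \<inter> L = {}" 
        using PQV[OF i] by (auto simp: L_def) (meson leD p(2))
      have seg: "initial_segment p V L" unfolding initial_segment_def L_def by (blast intro: order_trans)
      \<comment> \<open>Reflecting \<open>L\<close> by the involution corresponds to reflecting the
        order, from \<open>p\<close> to \<open>p \<circ> \<sigma> i\<close>.\<close>
      have seg': "initial_segment (p \<circ> \<sigma> i) V (\<sigma> i ` L)"
        unfolding initial_segment_def
      proof (intro conjI ballI impI)
        show "\<sigma> i ` L \<subseteq> V" using permutes_image[OF \<sigma>V[OF i]] by (auto simp: L_def)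
        fix x y assume "x \<in> \<sigma> i ` L" "y \<in> V" "(p \<circ> \<sigma> i) y \<le> (p \<circ> \<sigma> i) x"
        then have "\<sigma> i x \<in> L" "\<sigma> i y \<in> V" "p (\<sigma> i y) \<le> p (\<sigma> i x)"
          using \<sigma>(2)[OF i] permutes_in_image[OF \<sigma>V[OF i]] by auto
        then have "\<sigma> i y \<in> L" using seg by (auto simp: initial_segment_def)
        then show "y \<in> \<sigma> i ` L" using \<sigma>(2)[OF i] by (metis image_eqI)
      qed
      have "p \<circ> \<sigma> i permutes V" using permutes_compose[OF \<sigma>V[OF i] p(1)] .
      then show "p \<in> ?G \<union> {p \<in> ?S. p \<circ> \<sigma> i \<in> ?G}"
        using good[OF i L] seg seg' p(1) by blast
    qed
    then have "card ?X \<le> card (?G \<union> {p \<in> ?S. p \<circ> \<sigma> i \<in> ?G})" using finG finS by (intro card_mono) auto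
    also have "\<dots> \<le> card ?G + card {p \<in> ?S. p \<circ> \<sigma> i \<in> ?G}" by (rule card_Un_le)
    also have "card {p \<in> ?S. p \<circ> \<sigma> i \<in> ?G} \<le> card ?G"
    proof (rule card_preimage_le)
      show "inj_on (\<lambda>p. p \<circ> \<sigma> i) ?S"
        using permutes_surj[OF \<sigma>V[OF i]] by (intro inj_onI) (metis surj_fun_eq)
    qed (fact finG)
    finally have "card ?X \<le> 2 * card ?G" by simp
    then have "((card (P i) + card (Q i)) choose card (P i)) * card ?X
        \<le> ((card (P i) + card (Q i)) choose card (P i)) * (2 * card ?G)" by (rule mult_le_mono2)
    then have "card ?S \<le> 2 * ((card (P i) + card (Q i)) choose card (P i)) * card ?G"
      using card_permutations_separating[OF V(1) PQV[OF i]] PQ[OF i] by linarith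
    then have "real (card ?S) \<le> real (2 * ((card (P i) + card (Q i)) choose card (P i)) * card ?G)"
      by (simp only: of_nat_le_iff)
    then show "?G \<subseteq> ?S \<and> real (card ?S) \<le> 2 * real ((card (P i) + card (Q i)) choose card (P i)) * real (card ?G)
        \<and> 0 < 2 * real ((card (P i) + card (Q i)) choose card (P i))" by auto
  next
    fix p assume "p \<in> ?S"
    \<comment> \<open>Two initial segments are nested, but in an unknown direction, so only one of
      the two cliques is usable. A common share \<open>a\<close> makes either direction
      contradictory; summing over the shares costs the factor \<open>Suc k\<close>.\<close>
    have "i = j" if ij: "i \<in> I" "j \<in> I" "a \<le> k" "p \<in> ?F i a" "p \<in> ?F j a" for i j a
    proof (rule ccontr)
      assume "i \<noteq> j"
      obtain L L' where L: "initial_segment p V L" "splits E (A i) (B i) k a L"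
        "initial_segment p V L'" "splits E (A j) (B j) k a L'" using ij by blast
      then show False
        using initial_segment_total[OF L(1,3)] excl[OF ij(1,2) \<open>i \<noteq> j\<close> ij(3)] excl[OF ij(2,1) _ ij(3)] \<open>i \<noteq> j\<close> by metis
    qed
    then have le1: "card {i \<in> I. p \<in> ?F i a} \<le> 1" if "a \<le> k" for a
      using I that by (intro card_le_one_if_unique) blast+
    have "{i \<in> I. p \<in> (\<Union>a\<le>k. ?F i a)} = (\<Union>a\<le>k. {i \<in> I. p \<in> ?F i a})" by blast
    then have "card {i \<in> I. p \<in> (\<Union>a\<le>k. ?F i a)} \<le> (\<Sum>a\<le>k. card {i \<in> I. p \<in> ?F i a})"
      using card_UN_le[of "{..k}" "\<lambda>a. {i \<in> I. p \<in> ?F i a}"] by simp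
    also have "\<dots> \<le> (\<Sum>a\<le>k. 1)" using le1 by (intro sum_mono) simp
    finally show "card {i \<in> I. p \<in> (\<Union>a\<le>k. ?F i a)} \<le> Suc k" by simp
  qed
  have half: "(\<Sum>i\<in>I. 1 / (2 * c i)) = (\<Sum>i\<in>I. 1 / c i) / 2" for c :: "'i \<Rightarrow> real"
    by (simp add: sum_divide_distrib mult.commute)
  show ?thesis
  proof (rule exI[of _ "\<lambda>i. card (P i)"], rule exI[of _ "\<lambda>i. card (Q i)"], intro conjI)
    show "(\<Sum>i\<in>I. 1 / 2 ^ (card (P i) + card (Q i))) \<le> (2::real)"
      using coins half[of "\<lambda>i. 2 ^ (card (P i) + card (Q i))"] by simp
    show "(\<Sum>i\<in>I. 1 / real ((card (P i) + card (Q i)) choose card (P i))) \<le> 2 * (real k + 1)"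
      using orders unfolding half by simp
  qed (use card_PQ in auto)
qed

section \<open>Far-apart representatives in a graph\<close>

definition nbrs :: "('a \<Rightarrow> 'a \<Rightarrow> bool) \<Rightarrow> 'a set \<Rightarrow> 'a \<Rightarrow> 'a set" where
  "nbrs R S v = {w \<in> S. R v w}"

text \<open>Distance at most three in the graph \<open>R\<close> on \<open>S\<close>.\<close>

definition close :: "('a \<Rightarrow> 'a \<Rightarrow> bool) \<Rightarrow> 'a set \<Rightarrow> 'a \<Rightarrow> 'a \<Rightarrow> bool" where
  "close R S x y \<longleftrightarrow> (\<exists>a\<in>insert x (nbrs R S x). \<exists>b\<in>insert a (nbrs R S a). y \<in> insert b (nbrs R S b))"

lemma card_UN_le_mult:
  assumes "finite A" "\<And>a. a \<in> A \<Longrightarrow> card (f a) \<le> n"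
  shows "card (\<Union>a\<in>A. f a) \<le> card A * n"
proof -
  have "card (\<Union>a\<in>A. f a) \<le> (\<Sum>a\<in>A. card (f a))" by (rule card_UN_le[OF assms(1)])
  also have "\<dots> \<le> card A * n" using sum_bounded_above[of A "\<lambda>a. card (f a)" n] assms(2) by simp
  finally show ?thesis .
qed

text \<open>The walks are counted outward from \<open>v\<close>, so degree bounds at
  \<open>v\<close>, \<open>a\<close> and \<open>b\<close> suffice, and the end \<open>x\<close>, the
  vertex that will be charged to \<open>v\<close>, may have any degree.\<close>

lemma card_bounded_degree_walks:
  assumes S: "finite S" and v: "card (nbrs R S v) \<le> d"
  defines "N \<equiv> \<lambda>x. insert x (nbrs R S x)"
  shows "card {x. \<exists>a\<in>N v. \<exists>b\<in>N a. card (nbrs R S a) \<le> d \<and> card (nbrs R S b) \<le> d \<and> x \<in> N b}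
    \<le> (d + 1) ^ 3"
proof -
  let ?M = "\<lambda>x. {a \<in> N x. card (nbrs R S a) \<le> d}"
  have fin: "finite (N x)" for x using S by (simp add: N_def nbrs_def)
  have deg: "card (N x) \<le> d + 1" if "card (nbrs R S x) \<le> d" for x
    using that card_insert_le_m1[of "d + 1" "nbrs R S x" x] by (simp add: N_def)
  have degM: "card (?M x) \<le> d + 1" if "card (nbrs R S x) \<le> d" for x
    using deg[OF that] card_mono[OF fin, of "?M x" x] by auto
  have finM: "finite (?M x)" for x using fin by simp
  have "card (\<Union>b\<in>?M a. N b) \<le> (d + 1) ^ 2" if "a \<in> ?M v" for a
  proof -
    have "card (\<Union>b\<in>?M a. N b) \<le> card (?M a) * (d + 1)"
      using finM deg by (intro card_UN_le_mult) auto
    also have "\<dots> \<le> (d + 1) * (d + 1)" using degM[of a] that by (intro mult_right_mono) auto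
    finally show ?thesis by (simp add: power2_eq_square)
  qed
  then have "card (\<Union>a\<in>?M v. \<Union>b\<in>?M a. N b) \<le> card (?M v) * (d + 1) ^ 2"
    using finM by (intro card_UN_le_mult) auto
  also have "\<dots> \<le> (d + 1) * (d + 1) ^ 2"
    using degM[OF v] by (intro mult_right_mono) auto
  also have "\<dots> = (d + 1) ^ 3" by (simp add: power3_eq_cube power2_eq_square)
  finally have "card (\<Union>a\<in>?M v. \<Union>b\<in>?M a. N b) \<le> (d + 1) ^ 3" .
  moreover have "{x. \<exists>a\<in>N v. \<exists>b\<in>N a. card (nbrs R S a) \<le> d \<and> card (nbrs R S b) \<le> d \<and> x \<in> N b}
      = (\<Union>a\<in>?M v. \<Union>b\<in>?M a. N b)" by blast
  ultimately show ?thesis by simp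
qed

lemma close_sym:
  assumes "symp R" "x \<in> S" "y \<in> S" "close R S x y"
  shows "close R S y x"
proof -
  let ?N = "\<lambda>x. insert x (nbrs R S x)"
  have sym: "a \<in> ?N b" if "b \<in> ?N a" "a \<in> S" for a b
    using that assms(1) by (auto simp: nbrs_def dest: sympD)
  obtain a b where ab: "a \<in> ?N x" "b \<in> ?N a" "y \<in> ?N b" using assms(4) by (auto simp: close_def)
  then have "a \<in> S" "b \<in> S" using assms(2) by (auto simp: nbrs_def)
  then show ?thesis using ab sym assms unfolding close_def by meson
qed

text \<open>Take an element of largest \<open>h\<close>, discard everything related to it, and
  repeat. Choosing by largest \<open>h\<close> ensures that a discarded element never outweighs its
  representative.\<close>

lemma greedy_independent:
  fixes h :: "'a \<Rightarrow> nat"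
  assumes "finite Y" "\<And>x y. x \<in> Y \<Longrightarrow> y \<in> Y \<Longrightarrow> r x y \<Longrightarrow> r y x" "\<And>x. x \<in> Y \<Longrightarrow> r x x"
  shows "\<exists>Z\<subseteq>Y. (\<forall>x\<in>Z. \<forall>y\<in>Z. x \<noteq> y \<longrightarrow> \<not> r x y) \<and> (\<forall>y\<in>Y. \<exists>z\<in>Z. r z y \<and> h y \<le> h z)"
  using assms
proof (induction "card Y" arbitrary: Y rule: less_induct)
  case less
  show ?case
  proof (cases "Y = {}")
    case False
    then have "Max (h ` Y) \<in> h ` Y" using less.prems(1) by (intro Max_in) auto
    then obtain m where "m \<in> Y" "h m = Max (h ` Y)" by auto
    then have m: "m \<in> Y" "\<And>y. y \<in> Y \<Longrightarrow> h y \<le> h m" using less.prems(1) by auto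
    let ?Y = "{y \<in> Y. \<not> r m y}"
    have "?Y \<subset> Y" using m(1) less.prems(3) by blast
    then have "card ?Y < card Y" by (rule psubset_card_mono[OF less.prems(1)])
    then have "\<exists>Z\<subseteq>?Y. (\<forall>x\<in>Z. \<forall>y\<in>Z. x \<noteq> y \<longrightarrow> \<not> r x y) \<and> (\<forall>y\<in>?Y. \<exists>z\<in>Z. r z y \<and> h y \<le> h z)"
      using less.prems by (intro less.hyps) auto
    then obtain Z where Z: "Z \<subseteq> ?Y" "\<forall>x\<in>Z. \<forall>y\<in>Z. x \<noteq> y \<longrightarrow> \<not> r x y" "\<forall>y\<in>?Y. \<exists>z\<in>Z. r z y \<and> h y \<le> h z"
      by blast
    show ?thesis
    proof (intro exI[of _ "insert m Z"] conjI ballI impI)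
      show "insert m Z \<subseteq> Y" using Z m by auto
      fix x y assume "x \<in> insert m Z" "y \<in> insert m Z" "x \<noteq> y"
      then show "\<not> r x y" using Z m less.prems(2) by blast
    next
      fix y assume "y \<in> Y"
      then show "\<exists>z\<in>insert m Z. r z y \<and> h y \<le> h z" using Z m by blast
    qed
  qed auto
qed

text \<open>The doubled exponent provides slack: one half pays for the jump, as
  \<open>2 * h x \<le> h (nxt x)\<close>, the other for the at most \<open>(h v + 1) ^ 3\<close>
  vertices that jump to the same \<open>v\<close>. The jumping vertices thus carry at most half of
  the total weight.\<close>

lemma sum_power_next_le:
  fixes h :: "'a \<Rightarrow> nat" and \<delta> :: real
  assumes S: "finite S" and X: "X \<subseteq> S" and \<delta>: "\<delta> \<ge> 1"
    and K: "K \<ge> 2" "\<And>n. n \<ge> K \<Longrightarrow> 2 * (real n + 1) ^ 3 \<le> \<delta> ^ n"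
    and h: "\<And>x. x \<in> X \<Longrightarrow> h x \<ge> 1"
    and nxt: "\<And>x. x \<in> X \<Longrightarrow> nxt x \<in> S \<and> K * h x \<le> h (nxt x)"
    and pre: "\<And>v. v \<in> S \<Longrightarrow> card {x \<in> X. nxt x = v} \<le> (h v + 1) ^ 3"
  shows "2 * (\<Sum>x\<in>X. \<delta> ^ (2 * h x)) \<le> (\<Sum>v\<in>S. \<delta> ^ (2 * h v))"
proof -
  have finX: "finite X" using S X finite_subset by blast
  have "(\<Sum>x\<in>X. \<delta> ^ (2 * h x)) \<le> (\<Sum>x\<in>X. \<delta> ^ h (nxt x))"
  proof (rule sum_mono)
    fix x assume "x \<in> X"
    then have "2 * h x \<le> h (nxt x)" using nxt[of x] K(1) mult_le_mono1[of 2 K "h x"] by linarith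
    then show "\<delta> ^ (2 * h x) \<le> \<delta> ^ h (nxt x)" using \<delta> by (rule power_increasing)
  qed
  also have "\<dots> = (\<Sum>v\<in>S. \<Sum>x\<in>{x \<in> X. nxt x = v}. \<delta> ^ h (nxt x))"
    using nxt by (intro sum.group[OF finX S, symmetric]) auto
  also have "\<dots> \<le> (\<Sum>v\<in>S. \<delta> ^ (2 * h v) / 2)"
  proof (rule sum_mono)
    fix v assume v: "v \<in> S"
    let ?P = "{x \<in> X. nxt x = v}"
    have "(\<Sum>x\<in>?P. \<delta> ^ h (nxt x)) = (\<Sum>x\<in>?P. \<delta> ^ h v)" by (rule sum.cong) auto
    then have eq: "(\<Sum>x\<in>?P. \<delta> ^ h (nxt x)) = real (card ?P) * \<delta> ^ h v" by simp
    show "(\<Sum>x\<in>?P. \<delta> ^ h (nxt x)) \<le> \<delta> ^ (2 * h v) / 2"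
    proof (cases "?P = {}")
      case True
      then show ?thesis using \<delta> by (simp only: sum.empty) simp
    next
      case False
      then obtain x where "x \<in> X" "nxt x = v" by auto
      then have "K \<le> h v" using nxt h by (metis One_nat_def mult.right_neutral mult_le_mono2 le_trans)
      have "real (card ?P) \<le> (real (h v) + 1) ^ 3"
        using pre[OF v] by (metis of_nat_1 of_nat_add of_nat_le_iff of_nat_power)
      also have "\<dots> \<le> \<delta> ^ h v / 2" using K(2)[OF \<open>K \<le> h v\<close>] by simp
      finally have "real (card ?P) * \<delta> ^ h v \<le> \<delta> ^ h v / 2 * \<delta> ^ h v"
        using \<delta> by (intro mult_right_mono) auto
      then show ?thesis unfolding eq by (simp add: power_add mult_2)
    qed
  qed
  also have "\<dots> = (\<Sum>v\<in>S. \<delta> ^ (2 * h v)) / 2" by (simp add: sum_divide_distrib)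
  finally show ?thesis by simp
qed

text \<open>The base \<open>11 / 10\<close> only has to exceed 1 and have a square below
  \<open>3 / 2\<close>; the quotient of that square by \<open>3 / 2\<close> is
  \<open>121 / 150\<close>, whose powers absorb any polynomial.\<close>

lemma exists_growth_constants:
  obtains K :: nat and C :: real where "K \<ge> 2" "C > 0"
    "\<And>n. n \<ge> K \<Longrightarrow> 2 * (real n + 1) ^ 3 \<le> (11 / 10) ^ n"
    "\<And>n. (11 / 10) ^ (2 * n) * (real K * real n + 1) ^ 3 \<le> C * (3 / 2) ^ n"
proof -
  have "eventually (\<lambda>n::nat. 2 * (real n + 1) ^ 3 \<le> (11 / 10) ^ n) at_top" by real_asymp
  then obtain K0 where K0: "\<And>n. n \<ge> K0 \<Longrightarrow> 2 * (real n + 1) ^ 3 \<le> (11 / 10) ^ n"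
    by (auto simp: eventually_at_top_linorder)
  define K where "K = max 2 K0"
  have "real K > 0" by (simp add: K_def)
  then have "(\<lambda>n::nat. (121 / 150) ^ n * (real K * real n + 1) ^ 3) \<longlonglongrightarrow> 0" by real_asymp
  then have "Bseq (\<lambda>n::nat. (121 / 150) ^ n * (real K * real n + 1) ^ 3)"
    using convergent_imp_Bseq convergentI by blast
  then obtain C where C: "C > 0" "\<And>n. norm ((121 / 150) ^ n * (real K * real n + 1) ^ 3) \<le> C"
    by (auto simp: Bseq_def)
  have "(11 / 10) ^ (2 * n) * (real K * real n + 1) ^ 3 \<le> C * (3 / 2) ^ n" for n
  proof -
    have "(11 / 10 :: real) ^ (2 * n) = (121 / 150) ^ n * (3 / 2) ^ n"
      by (simp add: power_mult power_mult_distrib[symmetric] power2_eq_square)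
    then have "(11 / 10) ^ (2 * n) * (real K * real n + 1) ^ 3
        = ((121 / 150) ^ n * (real K * real n + 1) ^ 3) * (3 / 2) ^ n" by simp
    also have "\<dots> \<le> C * (3 / 2) ^ n" using C(2)[of n] by (intro mult_right_mono) auto
    finally show ?thesis .
  qed
  then show thesis using K0 C(1) by (intro that[of K C]) (auto simp: K_def)
qed

text \<open>A ball of radius three can be far larger than any power of the degree of its centre, so
  a greedy choice alone gives no bound. The vertices of \<open>Y\<close> carry at least half of the
  weight \<open>\<delta> ^ (2 * h)\<close>, and since their degrees are within a factor
  \<open>K\<close> of all degrees nearby, their balls are polynomial in \<open>h\<close>;
  \<open>(3 / 2) ^ h\<close> absorbs both.\<close>

lemma exists_far_apart_representatives:
  "\<exists>C>0. \<forall>(S :: 'a set) R. finite S \<longrightarrow> symp R \<longrightarrow> (\<forall>v\<in>S. nbrs R S v \<noteq> {}) \<longrightarrow>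
     (\<exists>Z\<subseteq>S. (\<forall>x\<in>Z. \<forall>y\<in>Z. x \<noteq> y \<longrightarrow> \<not> close R S x y) \<and>
        real (card S) \<le> C * (\<Sum>z\<in>Z. (3 / 2) ^ card (nbrs R S z)))"
proof -
  obtain K and C :: real where K: "K \<ge> 2" "\<And>n. n \<ge> K \<Longrightarrow> 2 * (real n + 1) ^ 3 \<le> (11 / 10) ^ n"
    and C: "C > 0" "\<And>n. (11 / 10) ^ (2 * n) * (real K * real n + 1) ^ 3 \<le> C * (3 / 2) ^ n"
    using exists_growth_constants by metis
  define \<delta> :: real where "\<delta> = 11 / 10"
  have \<delta>: "\<delta> \<ge> 1" by (simp add: \<delta>_def)
  have "\<exists>Z\<subseteq>S. (\<forall>x\<in>Z. \<forall>y\<in>Z. x \<noteq> y \<longrightarrow> \<not> close R S x y) \<and>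
        real (card S) \<le> (2 * C) * (\<Sum>z\<in>Z. (3 / 2) ^ card (nbrs R S z))"
    if S: "finite S" and R: "symp R" and ne: "\<forall>v\<in>S. nbrs R S v \<noteq> {}" for S :: "'a set" and R
  proof -
    define h where "h v = card (nbrs R S v)" for v
    have h1: "h v \<ge> 1" if "v \<in> S" for v
      using ne that S by (auto simp: h_def nbrs_def Suc_le_eq card_gt_0_iff)
    have closeS: "y \<in> S" if "x \<in> S" "close R S x y" for x y using that by (auto simp: close_def nbrs_def)
    define N where "N x = insert x (nbrs R S x)" for x
    have N_sym: "a \<in> N b" if "b \<in> N a" "a \<in> S" for a b
      using that R by (auto simp: N_def nbrs_def dest: sympD)
    have refl: "close R S x x" for x by (auto simp: close_def)
    txt \<open>A vertex outside \<open>Y\<close> is charged to a vertex of maximum degree close to it.  This multiplies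
      the degree by \<open>K\<close>, and only polynomially many vertices are charged to the same one because all
      degrees on the way are bounded by the degree at the end.\<close>
    define Y where "Y = {y \<in> S. \<forall>z. close R S y z \<longrightarrow> h z \<le> K * h y}"
    have "\<exists>v. close R S x v \<and> K * h x \<le> h v \<and> (\<forall>z. close R S x z \<longrightarrow> h z \<le> h v)" if x: "x \<in> S - Y" for x
    proof -
      let ?B = "{z. close R S x z}"
      have fin: "finite ?B" using closeS x S by (intro finite_subset[of ?B S]) auto
      obtain z where z: "close R S x z" "K * h x < h z" using x by (auto simp: Y_def not_le)
      obtain v where v: "v \<in> ?B" "h v = Max (h ` ?B)"
        using Max_in[of "h ` ?B"] fin refl by (metis (mono_tags, lifting) empty_iff finite_imageI imageE image_is_empty mem_Collect_eq)
      have "\<forall>z. close R S x z \<longrightarrow> h z \<le> h v" using v fin by simp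
      then show ?thesis using z v by (intro exI[of _ v]) auto
    qed
    then obtain nxt where nxt: "\<And>x. x \<in> S - Y \<Longrightarrow>
        close R S x (nxt x) \<and> K * h x \<le> h (nxt x) \<and> (\<forall>z. close R S x z \<longrightarrow> h z \<le> h (nxt x))"
      by metis
    have "2 * (\<Sum>x\<in>S - Y. \<delta> ^ (2 * h x)) \<le> (\<Sum>v\<in>S. \<delta> ^ (2 * h v))"
    proof (rule sum_power_next_le[OF S _ \<delta> K(1), where nxt = nxt])
      show "2 * (real n + 1) ^ 3 \<le> \<delta> ^ n" if "K \<le> n" for n using K(2)[OF that] by (simp add: \<delta>_def)
      show "1 \<le> h x" if "x \<in> S - Y" for x using h1 that by blast
      show "nxt x \<in> S \<and> K * h x \<le> h (nxt x)" if "x \<in> S - Y" for x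
        using nxt[OF that] closeS that by blast
      show "card {x \<in> S - Y. nxt x = v} \<le> (h v + 1) ^ 3" if v: "v \<in> S" for v
      proof -
        let ?W = "{x. \<exists>a\<in>N v. \<exists>b\<in>N a. h a \<le> h v \<and> h b \<le> h v \<and> x \<in> N b}"
        have "{x \<in> S - Y. nxt x = v} \<subseteq> ?W"
        proof
          fix x assume "x \<in> {x \<in> S - Y. nxt x = v}"
          then have x: "x \<in> S" "close R S x v" "\<And>z. close R S x z \<Longrightarrow> h z \<le> h v" using nxt by auto
          obtain a b where ab: "a \<in> N x" "b \<in> N a" "v \<in> N b" using x(2) by (auto simp: close_def N_def)
          have "a \<in> S" "b \<in> S" using ab x(1) by (auto simp: N_def nbrs_def)
          moreover have "h a \<le> h v" "h b \<le> h v" using ab by (intro x(3); auto simp: close_def N_def)+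
          ultimately show "x \<in> ?W" using ab N_sym x(1) by blast
        qed
        moreover have "?W \<subseteq> S" using v by (auto simp: N_def nbrs_def)
        ultimately have "card {x \<in> S - Y. nxt x = v} \<le> card ?W" using S by (meson card_mono finite_subset)
        also have "\<dots> \<le> (h v + 1) ^ 3"
          using card_bounded_degree_walks[OF S, of R v "h v"] by (simp add: h_def N_def)
        finally show ?thesis .
      qed
    qed auto
    then have "(\<Sum>v\<in>S. \<delta> ^ (2 * h v)) \<le> 2 * (\<Sum>y\<in>Y. \<delta> ^ (2 * h y))"
      using sum.subset_diff[of Y S "\<lambda>v. \<delta> ^ (2 * h v)"] S by (auto simp: Y_def)
    moreover have "real (card S) \<le> (\<Sum>v\<in>S. \<delta> ^ (2 * h v))"
      using sum_mono[of S "\<lambda>_. 1" "\<lambda>v. \<delta> ^ (2 * h v)"] \<delta> by (simp add: one_le_power)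
    ultimately have S_le: "real (card S) \<le> 2 * (\<Sum>y\<in>Y. \<delta> ^ (2 * h y))" by simp
    have YS: "Y \<subseteq> S" "finite Y" using S by (auto simp: Y_def)
    have "close R S y x" if "x \<in> Y" "y \<in> Y" "close R S x y" for x y
      using close_sym[OF R] that YS(1) by blast
    then have "\<exists>Z\<subseteq>Y. (\<forall>x\<in>Z. \<forall>y\<in>Z. x \<noteq> y \<longrightarrow> \<not> close R S x y) \<and>
        (\<forall>y\<in>Y. \<exists>z\<in>Z. close R S z y \<and> h y \<le> h z)"
      using YS(2) refl by (intro greedy_independent) auto
    then obtain Z where Z: "Z \<subseteq> Y" "\<forall>x\<in>Z. \<forall>y\<in>Z. x \<noteq> y \<longrightarrow> \<not> close R S x y"
        "\<forall>y\<in>Y. \<exists>z\<in>Z. close R S z y \<and> h y \<le> h z"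
      by blast
    then obtain rep where rep: "\<And>y. y \<in> Y \<Longrightarrow> rep y \<in> Z \<and> close R S (rep y) y \<and> h y \<le> h (rep y)" by metis
    have finZ: "finite Z" using Z YS finite_subset by blast
    have "(\<Sum>y\<in>Y. \<delta> ^ (2 * h y)) \<le> (\<Sum>y\<in>Y. \<delta> ^ (2 * h (rep y)))"
      using rep \<delta> by (intro sum_mono power_increasing) auto
    also have "\<dots> = (\<Sum>z\<in>Z. \<Sum>y\<in>{y \<in> Y. rep y = z}. \<delta> ^ (2 * h (rep y)))"
      using rep by (intro sum.group[OF YS(2) finZ, symmetric]) auto
    also have "\<dots> \<le> (\<Sum>z\<in>Z. C * (3 / 2) ^ h z)"
    proof (rule sum_mono)
      fix z assume z: "z \<in> Z"
      let ?P = "{y \<in> Y. rep y = z}"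
      let ?W = "{x. \<exists>a\<in>N z. \<exists>b\<in>N a. h a \<le> K * h z \<and> h b \<le> K * h z \<and> x \<in> N b}"
      have zY: "z \<in> S" "\<And>w. close R S z w \<Longrightarrow> h w \<le> K * h z" using z Z(1) by (auto simp: Y_def)
      have "?P \<subseteq> ?W"
      proof
        fix y assume "y \<in> ?P"
        then have "close R S z y" using rep by blast
        then obtain a b where ab: "a \<in> N z" "b \<in> N a" "y \<in> N b" unfolding close_def N_def by blast
        moreover have "h a \<le> K * h z" "h b \<le> K * h z" using ab by (intro zY(2); auto simp: close_def N_def)+
        ultimately show "y \<in> ?W" by blast
      qed
      moreover have "?W \<subseteq> S" using zY(1) by (auto simp: N_def nbrs_def)
      ultimately have "card ?P \<le> card ?W" using S by (meson card_mono finite_subset)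
      also have "\<dots> \<le> (K * h z + 1) ^ 3"
        using card_bounded_degree_walks[OF S, of R z "K * h z"] zY(2)[OF refl] by (simp add: h_def N_def)
      finally have "real (card ?P) \<le> (real K * real (h z) + 1) ^ 3"
        by (metis of_nat_1 of_nat_add of_nat_le_iff of_nat_mult of_nat_power)
      then have "\<delta> ^ (2 * h z) * real (card ?P) \<le> \<delta> ^ (2 * h z) * (real K * real (h z) + 1) ^ 3"
        using \<delta> by (intro mult_left_mono) auto
      also have "\<dots> \<le> C * (3 / 2) ^ h z" using C(2) by (simp add: \<delta>_def)
      finally have "\<delta> ^ (2 * h z) * real (card ?P) \<le> C * (3 / 2) ^ h z" .
      moreover have "(\<Sum>y\<in>?P. \<delta> ^ (2 * h (rep y))) = (\<Sum>y\<in>?P. \<delta> ^ (2 * h z))" by (rule sum.cong) auto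
      ultimately show "(\<Sum>y\<in>?P. \<delta> ^ (2 * h (rep y))) \<le> C * (3 / 2) ^ h z" by (simp add: mult.commute)
    qed
    finally have "(\<Sum>y\<in>Y. \<delta> ^ (2 * h y)) \<le> C * (\<Sum>z\<in>Z. (3 / 2) ^ h z)" by (simp add: sum_distrib_left)
    then have "real (card S) \<le> (2 * C) * (\<Sum>z\<in>Z. (3 / 2) ^ h z)" using S_le by simp
    then show ?thesis using Z YS(1) unfolding h_def by (intro exI[of _ Z]) auto
  qed
  then show ?thesis using C(1) by (intro exI[of _ "2 * C"]) auto
qed

section \<open>Saturated graphs with many low vertices\<close>

lemma in_nsets2: "x \<in> V \<Longrightarrow> y \<in> V \<Longrightarrow> x \<noteq> y \<Longrightarrow> {x, y} \<in> [V]\<^bsup>2\<^esup>"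
  by (auto simp: nsets_def)

lemma nsets2E:
  assumes "e \<in> [V]\<^bsup>2\<^esup>"
  obtains x y where "e = {x, y}" "x \<in> V" "y \<in> V" "x \<noteq> y"
  using assms by (auto simp: nsets_def card_2_iff)

lemma edge_in_nsets2: "finite_simple_graph V E \<Longrightarrow> {x, y} \<in> E \<Longrightarrow> x \<in> V \<and> y \<in> V \<and> x \<noteq> y"
  by (auto simp: finite_simple_graph_def nsets_def card_2_iff doubleton_eq_iff)

lemma degree_eq_card_neighbours:
  assumes G: "finite_simple_graph V E"
  shows "degree E v = card {w \<in> V. {v, w} \<in> E}"
proof -
  have "bij_betw (\<lambda>w. {v, w}) {w \<in> V. {v, w} \<in> E} {e \<in> E. v \<in> e}"
    unfolding bij_betw_def
  proof
    show "inj_on (\<lambda>w. {v, w}) {w \<in> V. {v, w} \<in> E}" by (auto simp: inj_on_def doubleton_eq_iff)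
    show "(\<lambda>w. {v, w}) ` {w \<in> V. {v, w} \<in> E} = {e \<in> E. v \<in> e}"
    proof (intro equalityI subsetI)
      fix e assume "e \<in> {e \<in> E. v \<in> e}"
      then have e: "e \<in> E" "v \<in> e" by auto
      then obtain x y where xy: "e = {x, y}" "x \<in> V" "y \<in> V"
        using G unfolding finite_simple_graph_def by (metis nsets2E subsetD)
      then obtain w where "w \<in> V" "e = {v, w}" using e(2) by (metis insertE insert_commute singletonD)
      then show "e \<in> (\<lambda>w. {v, w}) ` {w \<in> V. {v, w} \<in> E}" using e(1) by blast
    qed auto
  qed
  then show ?thesis unfolding degree_def by (simp add: bij_betw_same_card)
qed

lemma degree_mono_le:
  assumes "finite E" "E \<subseteq> F" "{e \<in> F. v \<in> e} \<subseteq> insert d E"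
  shows "degree F v \<le> degree E v + 1"
proof -
  have "{e \<in> F. v \<in> e} \<subseteq> insert d {e \<in> E. v \<in> e}" using assms(3) by auto
  then have "degree F v \<le> card (insert d {e \<in> E. v \<in> e})"
    unfolding degree_def using assms(1) by (intro card_mono) auto
  also have "\<dots> \<le> degree E v + 1" unfolding degree_def by (simp add: card_insert_if assms(1))
  finally show ?thesis .
qed

lemma finite_edges: "finite_simple_graph V E \<Longrightarrow> finite E"
  unfolding finite_simple_graph_def by (meson finite_imp_finite_nsets finite_subset)

text \<open>The new vertex is adjacent to everything: it adds at most one to a clique, and every
  missing edge lies inside \<open>V\<close>, where the saturation of the old graph applies.\<close>

lemma K_saturated_join:
  assumes K: "K_saturated r V E" and v: "v \<notin> V"
  defines "E' \<equiv> E \<union> (\<lambda>x. {v, x}) ` V"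
  shows "K_saturated (Suc r) (insert v V) E'"
proof -
  have G: "finite V" "E \<subseteq> [V]\<^bsup>2\<^esup>" using K by (auto simp: K_saturated_def finite_simple_graph_def)
  have E: "e \<subseteq> V" if "e \<in> E" for e using G(2) that by (auto simp: nsets_def)
  have "[V]\<^bsup>2\<^esup> \<subseteq> [insert v V]\<^bsup>2\<^esup>" by (rule nsets_mono) auto
  moreover have "(\<lambda>x. {v, x}) ` V \<subseteq> [insert v V]\<^bsup>2\<^esup>" using v by (auto intro!: in_nsets2)
  ultimately have simple: "finite_simple_graph (insert v V) E'"
    using G unfolding finite_simple_graph_def E'_def by blast
  have noK: "\<not> contains_K (Suc r) (insert v V) E'"
  proof
    assume "contains_K (Suc r) (insert v V) E'"
    then obtain K where K': "K \<subseteq> insert v V" "finite K" "card K = Suc r" "clique K E'"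
      by (auto simp: contains_K_def nsets_def)
    have "r \<le> card (K - {v})" using K'(2,3) by (cases "v \<in> K") auto
    then obtain L where L: "L \<subseteq> K - {v}" "card L = r" "finite L"
      by (meson obtain_subset_with_card_n)
    have "clique L E"
      unfolding clique_def
    proof (intro ballI impI)
      fix x y assume xy: "x \<in> L" "y \<in> L" "x \<noteq> y"
      then have "{x, y} \<in> E'" using K'(4) L(1) by (auto simp: clique_def)
      then show "{x, y} \<in> E" using xy L(1) by (auto simp: E'_def doubleton_eq_iff)
    qed
    then have "contains_K r V E" using L K'(1) by (auto simp: contains_K_def nsets_def)
    then show False using K by (simp add: K_saturated_def)
  qed
  have "contains_K (Suc r) (insert v V) (insert e E')" if e: "e \<in> [insert v V]\<^bsup>2\<^esup> - E'" for e
  proof -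
    obtain x y where xy: "e = {x, y}" "x \<in> insert v V" "y \<in> insert v V" "x \<noteq> y"
      using e by (auto elim: nsets2E)
    then have "x \<in> V" "y \<in> V" using e by (auto simp: E'_def insert_commute)
    then have "e \<in> [V]\<^bsup>2\<^esup> - E" using e xy by (auto simp: E'_def intro!: in_nsets2)
    then have "contains_K r V (insert e E)" using K by (simp add: K_saturated_def)
    then obtain L where L: "L \<subseteq> V" "finite L" "card L = r" "clique L (insert e E)"
      by (auto simp: contains_K_def nsets_def)
    have "clique (insert v L) (insert e E')"
      using L(1,4) by (auto simp: clique_def E'_def insert_commute)
    moreover have "v \<notin> L" using L v by blast
    then have "insert v L \<in> [insert v V]\<^bsup>Suc r\<^esup>" using L by (auto simp: nsets_def)
    ultimately show ?thesis by (auto simp: contains_K_def)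
  qed
  then show ?thesis using simple noK by (simp add: K_saturated_def)
qed

lemma low_counts_join:
  assumes "n \<in> low_counts r t"
  shows "\<exists>n'\<in>low_counts (Suc r) (Suc t). n \<le> n'"
proof -
  obtain V :: "nat set" and E where VE: "K_saturated r V E" "n = card (paired_low_vertices t V E)"
    using assms by (auto simp: low_counts_def)
  have G: "finite_simple_graph V E" using VE by (simp add: K_saturated_def)
  then have fin: "finite V" "finite E" using finite_edges by (auto simp: finite_simple_graph_def)
  obtain v where v: "v \<notin> V" using fin(1) infinite_UNIV_nat by (metis ex_new_if_finite)
  define E' where "E' = E \<union> (\<lambda>x. {v, x}) ` V"
  have sat: "K_saturated (Suc r) (insert v V) E'" unfolding E'_def by (rule K_saturated_join[OF VE(1) v])
  have deg: "degree E' x \<le> degree E x + 1" if "x \<in> V" for x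
    using v that by (intro degree_mono_le[where d = "{v, x}"] fin) (auto simp: E'_def)
  have "paired_low_vertices t V E \<subseteq> paired_low_vertices (Suc t) (insert v V) E'"
  proof
    fix x assume "x \<in> paired_low_vertices t V E"
    then obtain w where "x \<in> V" "degree E x \<le> t" "w \<in> V" "w \<noteq> x" "{x, w} \<in> E" "degree E w \<le> t"
      by (auto simp: paired_low_vertices_def)
    moreover then have "degree E' x \<le> Suc t" "degree E' w \<le> Suc t" "{x, w} \<in> E'"
      using deg[of x] deg[of w] by (auto simp: E'_def)
    ultimately show "x \<in> paired_low_vertices (Suc t) (insert v V) E'"
      unfolding paired_low_vertices_def by blast
  qed
  then have "n \<le> card (paired_low_vertices (Suc t) (insert v V) E')"
    unfolding VE(2) using fin(1) by (intro card_mono) (auto simp: paired_low_vertices_def)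
  then show ?thesis using sat unfolding low_counts_def by blast
qed

text \<open>Supplies the linear term of the lower bound and the nonemptiness of
  \<open>low_counts r t\<close>. A complete graph has no missing edge to test, and its degrees are
  \<open>r - 2\<close>.\<close>

lemma low_counts_complete:
  assumes "r \<ge> 3" "t \<ge> r - 2"
  shows "r - 1 \<in> low_counts r t"
proof -
  let ?V = "{..<r - 1}" and ?E = "[{..<r - 1}]\<^bsup>2\<^esup>"
  have G: "finite_simple_graph ?V ?E" by (simp add: finite_simple_graph_def)
  have "\<not> contains_K r ?V ?E"
  proof
    assume "contains_K r ?V ?E"
    then obtain K where "K \<subseteq> ?V" "card K = r" by (auto simp: contains_K_def nsets_def)
    then have "r \<le> r - 1" by (metis card_lessThan card_mono finite_lessThan)
    then show False using assms by simp
  qed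
  then have sat: "K_saturated r ?V ?E" using G by (simp add: K_saturated_def)
  have deg: "degree ?E v \<le> t" if "v < r - 1" for v
  proof -
    have "{w \<in> ?V. {v, w} \<in> ?E} \<subseteq> ?V - {v}" by (auto simp: nsets_def)
    then have "card {w \<in> ?V. {v, w} \<in> ?E} \<le> card (?V - {v})" by (intro card_mono) auto
    also have "\<dots> = r - 2" using that by simp
    finally show ?thesis using degree_eq_card_neighbours[OF G] assms by simp
  qed
  have "v \<in> paired_low_vertices t ?V ?E" if v: "v < r - 1" for v
  proof -
    obtain w where "w < r - 1" "w \<noteq> v" using assms(1)
      by (metis One_nat_def Suc_lessI diff_less_mono2 less_diff_conv linorder_not_less nat_1_add_1 numeral_3_eq_3 not_less_eq_eq
          one_add_one zero_less_Suc zero_less_diff lessI less_trans)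
    then show ?thesis using v deg unfolding paired_low_vertices_def
      by (auto intro!: bexI[of _ w] in_nsets2)
  qed
  then have "paired_low_vertices t ?V ?E = ?V" by (auto simp: paired_low_vertices_def)
  then show ?thesis using sat unfolding low_counts_def by (intro CollectI exI[of _ ?V] exI[of _ ?E]) simp
qed

text \<open>For \<open>r = 3\<close>, saturation means no triangle and a common neighbour for each
  nonadjacent pair. Two points share an \<open>m\<close>-set, a point outside \<open>A\<close> lies
  in \<open>X - A\<close>, and \<open>m\<close>-sets that are not complementary intersect because
  \<open>X\<close> has only \<open>2 * m\<close> points. The edges between complements provide each
  \<open>m\<close>-set with its low neighbour.\<close>

lemma triangle_free_base:
  assumes m: "m \<ge> 2"
  shows "\<exists>n\<in>low_counts 3 (m + 1). (2 * m choose m) \<le> n"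
proof -
  define X where "X = {..<2 * m}"
  define F where "F = {A. A \<subseteq> X \<and> card A = m}"
  \<comment> \<open>The offset keeps the codes of the \<open>m\<close>-sets apart from the points
    \<open>{..<2 * m}\<close>.\<close>
  define e where "e A = 2 * m + set_encode A" for A
  define V where "V = X \<union> e ` F"
  define E where "E = {{i, e A} | i A. A \<in> F \<and> i \<in> A} \<union> {{e A, e (X - A)} | A. A \<in> F}"
  have finX: "finite X" and cardX: "card X = 2 * m" by (auto simp: X_def)
  have F: "finite A" "A \<subseteq> X" "card A = m" if "A \<in> F" for A
    using that finX finite_subset by (auto simp: F_def)
  have finF: "finite F" using finX by (simp add: F_def)
  have compl: "X - A \<in> F" if "A \<in> F" for A
    using F[OF that] cardX by (simp add: F_def card_Diff_subset)
  have e_inj: "e A = e B \<longleftrightarrow> A = B" if "A \<in> F" "B \<in> F" for A B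
    using inj_onD[OF inj_on_set_encode, of A B] F that by (auto simp: e_def)
  have eX: "e A \<noteq> i" "i \<noteq> e A" if "i \<in> X" for A i using that by (auto simp: e_def X_def)
  have ne: "X - A \<noteq> A" if "A \<in> F" for A
    using F[OF that] m by (metis Diff_disjoint Int_absorb card.empty not_numeral_le_zero)
  have adj_XX: "{i, j} \<notin> E" if "i \<in> X" "j \<in> X" for i j
    using that eX by (auto simp: E_def doubleton_eq_iff)
  have adj_Xe: "{i, e A} \<in> E \<longleftrightarrow> i \<in> A" if "i \<in> X" "A \<in> F" for i A
    using that eX e_inj by (auto simp: E_def doubleton_eq_iff)
  have adj_ee: "{e A, e B} \<in> E \<longleftrightarrow> B = X - A" if "A \<in> F" "B \<in> F" for A B
  proof -
    have "e C \<noteq> i" if "C \<in> F" "D \<in> F" "i \<in> D" for i C D using eX F(2) that by blast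
    then show ?thesis using that e_inj compl F(2) by (auto simp: E_def doubleton_eq_iff) (blast | metis)+
  qed
  have G: "finite_simple_graph V E"
    unfolding finite_simple_graph_def
  proof
    show "finite V" using finX finF by (simp add: V_def)
    show "E \<subseteq> [V]\<^bsup>2\<^esup>"
    proof
      fix d assume "d \<in> E"
      then consider i A where "d = {i, e A}" "A \<in> F" "i \<in> A" | A where "d = {e A, e (X - A)}" "A \<in> F"
        by (auto simp: E_def)
      then show "d \<in> [V]\<^bsup>2\<^esup>"
      proof cases
        case 1
        then show ?thesis using F(2)[of A] eX[of i A] by (auto simp: V_def intro!: in_nsets2)
      next
        case 2
        then show ?thesis using compl[of A] e_inj ne[of A] by (auto simp: V_def intro!: in_nsets2)
      qed
    qed
  qed
  have noK: "\<not> contains_K 3 V E"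
  proof
    assume "contains_K 3 V E"
    then obtain K where K: "K \<subseteq> V" "card K = 3" "clique K E" by (auto simp: contains_K_def nsets_def)
    then obtain x y z where xyz: "K = {x, y, z}" "x \<noteq> y" "y \<noteq> z" "x \<noteq> z" by (auto simp: card_3_iff)
    then have a: "{x, y} \<in> E" "{y, z} \<in> E" "{x, z} \<in> E" "{y, x} \<in> E" "{z, y} \<in> E" "{z, x} \<in> E"
      using K(3) by (auto simp: clique_def insert_commute)
    have no1: False if "i \<in> X" "A \<in> F" "B \<in> F" "{i, e A} \<in> E" "{i, e B} \<in> E" "{e A, e B} \<in> E" for i A B
      using that adj_Xe adj_ee by auto
    have no3: False if "A \<in> F" "B \<in> F" "C \<in> F" "{e A, e B} \<in> E" "{e A, e C} \<in> E" "e B \<noteq> e C" for A B C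
      using that adj_ee by auto
    \<comment> \<open>A triangle through a point \<open>i\<close> would contain two complementary
      sets that both contain \<open>i\<close>. So a triangle consists of sets only, but a set has
      just one set as neighbour.\<close>
    have eF: "i \<in> e ` F" if H: "{i, j} \<in> E" "{i, k} \<in> E" "{j, k} \<in> E" "i \<in> V" "j \<in> V" "k \<in> V" for i j k
    proof (rule ccontr)
      assume "i \<notin> e ` F"
      then have "i \<in> X" using that by (simp add: V_def)
      then obtain A B where "A \<in> F" "B \<in> F" "j = e A" "k = e B" using H adj_XX unfolding V_def by blast
      then show False using no1 \<open>i \<in> X\<close> H by blast
    qed
    have V: "x \<in> V" "y \<in> V" "z \<in> V" using K(1) xyz(1) by auto
    obtain A B C where "A \<in> F" "B \<in> F" "C \<in> F" "x = e A" "y = e B" "z = e C"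
      using eF[OF a(1,3,2) V] eF[OF a(4,2,3) V(2,1,3)] eF[OF a(6,5,1) V(3,1,2)] by blast
    then show False using no3 a xyz by blast
  qed
  have common: "\<exists>z\<in>V. {x, z} \<in> E \<and> {y, z} \<in> E" if xy: "x \<in> V" "y \<in> V" "x \<noteq> y" "{x, y} \<notin> E" for x y
  proof -
    have XX: ?thesis if "x \<in> X" "y \<in> X"
    proof -
      \<comment> \<open>Two points are completed to an \<open>m\<close>-set by \<open>m - 2\<close>
        others, which needs \<open>m \<ge> 2\<close>.\<close>
      have "m - 2 \<le> card (X - {x, y})" using cardX that xy(3) by (simp add: card_Diff_subset)
      then obtain B where B: "B \<subseteq> X - {x, y}" "card B = m - 2" "finite B"
        by (meson obtain_subset_with_card_n)
      then have "card (insert x (insert y B)) = m" using xy(3) m by (subst card_insert_disjoint; auto)+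
      then have "insert x (insert y B) \<in> F" using B that by (auto simp: F_def)
      then show ?thesis using adj_Xe that by (intro bexI[of _ "e (insert x (insert y B))"]) (auto simp: V_def)
    qed
    have Xe: "\<exists>z\<in>V. {i, z} \<in> E \<and> {e A, z} \<in> E" if "i \<in> X" "A \<in> F" "{i, e A} \<notin> E" for i A
      using that adj_Xe adj_ee compl by (intro bexI[of _ "e (X - A)"]) (auto simp: V_def)
    have ee: "\<exists>z\<in>V. {e A, z} \<in> E \<and> {e B, z} \<in> E" if AB: "A \<in> F" "B \<in> F" "{e A, e B} \<notin> E" for A B
    proof -
      have "A \<inter> B \<noteq> {}"
      proof
        assume "A \<inter> B = {}"
        then have "B \<subseteq> X - A" using F(2)[OF AB(2)] by blast
        then have "B = X - A" using F(3)[OF AB(2)] F(3)[OF compl[OF AB(1)]] finX by (intro card_subset_eq) auto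
        then show False using AB adj_ee by blast
      qed
      then obtain i where "i \<in> A" "i \<in> B" by blast
      moreover then have "i \<in> X" using F(2) AB by blast
      ultimately show ?thesis
        using adj_Xe AB by (intro bexI[of _ i]) (auto simp: V_def insert_commute)
    qed
    consider "x \<in> X" "y \<in> X" | A where "x \<in> X" "A \<in> F" "y = e A" | A where "y \<in> X" "A \<in> F" "x = e A"
      | A B where "A \<in> F" "B \<in> F" "x = e A" "y = e B"
      using xy(1,2) by (auto simp: V_def)
    then show ?thesis
    proof cases
      case 1 then show ?thesis by (rule XX)
    next
      case 2 then show ?thesis using Xe xy(4) by blast
    next
      case 3 then show ?thesis using Xe[of y A] xy(4) by (auto simp: insert_commute)
    next
      case 4 then show ?thesis using ee xy(4) by blast
    qed
  qed
  have "contains_K 3 V (insert d E)" if d: "d \<in> [V]\<^bsup>2\<^esup> - E" for d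
  proof -
    obtain x y where xy: "d = {x, y}" "x \<in> V" "y \<in> V" "x \<noteq> y" using d by (auto elim: nsets2E)
    then obtain z where z: "z \<in> V" "{x, z} \<in> E" "{y, z} \<in> E" using common d by blast
    then have "x \<noteq> z" "y \<noteq> z" using edge_in_nsets2[OF G] by blast+
    then have "{x, y, z} \<in> [V]\<^bsup>3\<^esup>" using xy z by (auto simp: nsets_def)
    moreover have "clique {x, y, z} (insert d E)" using xy z by (auto simp: clique_def insert_commute)
    ultimately show ?thesis by (auto simp: contains_K_def)
  qed
  then have sat: "K_saturated 3 V E" using G noK by (simp add: K_saturated_def)
  have deg: "degree E (e A) \<le> m + 1" if A: "A \<in> F" for A
  proof -
    have "{w \<in> V. {e A, w} \<in> E} \<subseteq> insert (e (X - A)) A"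
      using adj_Xe[OF _ A] adj_ee[OF A] by (auto simp: V_def insert_commute)
    then have "card {w \<in> V. {e A, w} \<in> E} \<le> card (insert (e (X - A)) A)"
      using F(1)[OF A] by (intro card_mono) auto
    also have "\<dots> \<le> m + 1" using F(1,3)[OF A] by (simp add: card_insert_if)
    finally show ?thesis using degree_eq_card_neighbours[OF G] by simp
  qed
  have "e ` F \<subseteq> paired_low_vertices (m + 1) V E"
  proof
    fix v assume "v \<in> e ` F"
    then obtain A where A: "A \<in> F" "v = e A" by blast
    then show "v \<in> paired_low_vertices (m + 1) V E"
      using deg[OF A(1)] deg[OF compl[OF A(1)]] compl[OF A(1)] adj_ee[OF A(1) compl[OF A(1)]] ne[OF A(1)] e_inj
      unfolding paired_low_vertices_def by (auto simp: V_def intro!: bexI[of _ "e (X - A)"])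
  qed
  moreover have "card (e ` F) = (2 * m choose m)"
    using e_inj n_subsets[OF finX, of m] cardX by (subst card_image) (auto simp: inj_on_def F_def)
  moreover have "finite (paired_low_vertices (m + 1) V E)"
    using G by (auto simp: finite_simple_graph_def paired_low_vertices_def)
  ultimately have "(2 * m choose m) \<le> card (paired_low_vertices (m + 1) V E)" by (metis card_mono)
  then show ?thesis using sat unfolding low_counts_def by blast
qed

lemma low_counts_central_binomial:
  assumes "m \<ge> 2"
  shows "\<exists>n\<in>low_counts (3 + d) (m + 1 + d). (2 * m choose m) \<le> n"
proof (induction d)
  case 0
  then show ?case using triangle_free_base[OF assms] by simp
next
  case (Suc d)
  then show ?case using low_counts_join by (metis add_Suc_right le_trans)
qed

section \<open>Low vertices of a saturated graph\<close>

lemma clique_card_less: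
  assumes "\<not> contains_K r V E" "K \<subseteq> V" "clique K E" "finite K"
  shows "card K < r"
proof (rule ccontr)
  assume "\<not> card K < r"
  then obtain L where "L \<subseteq> K" "card L = r" "finite L" by (meson not_less obtain_subset_with_card_n)
  then have "L \<in> [V]\<^bsup>r\<^esup>" "clique L E" using assms clique_subset by (auto simp: nsets_def)
  then show False using assms(1) by (auto simp: contains_K_def)
qed

text \<open>A copy of \<open>K_r\<close> created by the new edge contains both of its ends; without
  them it is a clique among their common neighbours.\<close>

lemma nonadjacent_common_clique:
  assumes "K_saturated r V E" "x \<in> V" "y \<in> V" "x \<noteq> y" "{x, y} \<notin> E"
  shows "\<exists>Q\<subseteq>{q \<in> V. {x, q} \<in> E \<and> {y, q} \<in> E}. clique Q E \<and> card Q = r - 2"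
proof -
  have "{x, y} \<in> [V]\<^bsup>2\<^esup> - E" using assms in_nsets2 by auto
  then have "contains_K r V (insert {x, y} E)" using assms(1) by (simp add: K_saturated_def)
  then obtain K where K: "K \<subseteq> V" "finite K" "card K = r" "clique K (insert {x, y} E)"
    by (auto simp: contains_K_def nsets_def)
  have noK: "\<not> clique K E"
    using K(1-3) assms(1) by (auto simp: K_saturated_def contains_K_def nsets_def)
  have "clique K E" if "x \<notin> K \<or> y \<notin> K"
    using K(4) that unfolding clique_def by (metis doubleton_eq_iff insertE)
  then have xy: "x \<in> K" "y \<in> K" using noK by blast+
  let ?Q = "K - {x, y}"
  have adj: "{v, w} \<in> E" if "v \<in> K" "w \<in> ?Q" "v \<noteq> w" for v w
    using K(4) that by (auto simp: clique_def doubleton_eq_iff)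
  have "?Q \<subseteq> {q \<in> V. {x, q} \<in> E \<and> {y, q} \<in> E}" using adj xy K(1) by auto
  moreover have "clique ?Q E" using adj by (auto simp: clique_def)
  moreover have "card ?Q = r - 2" using K(2,3) xy assms(4) by (simp add: card_Diff_subset)
  ultimately show ?thesis by blast
qed

lemma clique_insert:
  "clique K E \<Longrightarrow> (\<And>q. q \<in> K \<Longrightarrow> {x, q} \<in> E) \<Longrightarrow> clique (insert x K) E"
  by (auto simp: clique_def insert_commute)

lemma clique_le_neighbourhood:
  assumes "finite_simple_graph V E" "\<not> contains_K r V E" "x \<in> V"
  shows "clique_le E {w \<in> V. {x, w} \<in> E} (r - 2)"
  unfolding clique_le_def
proof (intro allI impI)
  fix K assume K: "K \<subseteq> {w \<in> V. {x, w} \<in> E}" "clique K E"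
  have fin: "finite K" using K(1) assms(1) by (auto simp: finite_simple_graph_def intro: finite_subset)
  have "x \<notin> K" using K(1) edge_in_nsets2[OF assms(1)] by blast
  moreover have "card (insert x K) < r"
    using K assms fin clique_insert[OF K(2), of x] by (intro clique_card_less[OF assms(2)]) auto
  ultimately show "card K \<le> r - 2" using fin by simp
qed

lemma clique_le_common_neighbourhood:
  assumes "finite_simple_graph V E" "\<not> contains_K r V E" "{x, y} \<in> E"
  shows "clique_le E {w \<in> V. {x, w} \<in> E \<and> {y, w} \<in> E} (r - 3)"
  unfolding clique_le_def
proof (intro allI impI)
  fix K assume K: "K \<subseteq> {w \<in> V. {x, w} \<in> E \<and> {y, w} \<in> E}" "clique K E"
  have fin: "finite K" using K(1) assms(1) by (auto simp: finite_simple_graph_def intro: finite_subset)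
  have xy: "x \<in> V" "y \<in> V" "x \<noteq> y" using edge_in_nsets2[OF assms(1,3)] by auto
  have "x \<notin> insert y K" "y \<notin> K" using K(1) edge_in_nsets2[OF assms(1)] xy by blast+
  moreover have "clique (insert x (insert y K)) E"
    using K assms(3) by (intro clique_insert) auto
  then have "card (insert x (insert y K)) < r"
    using K xy fin by (intro clique_card_less[OF assms(2)]) auto
  ultimately show "card K \<le> r - 3" using fin by simp
qed

text \<open>Serves the case of fewer than two far-apart vertices. If every vertex other than
  \<open>u\<close> is adjacent to \<open>u\<close> or to one low neighbour \<open>z\<close> of
  \<open>u\<close>, the graph is small. Otherwise each low neighbour is avoided by some maximum
  clique in the neighbourhood of \<open>u\<close>; the intersection of these cliques then misses all
  low neighbours, and Hajnal's lemma bounds their number.\<close>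

lemma few_low_vertices_or_small_degree:
  fixes t :: nat
  assumes sat: "K_saturated r V E" and r: "r \<ge> 3"
  defines "S \<equiv> paired_low_vertices t V E"
  shows "card S \<le> 2 * t + 1 \<or> (\<forall>u\<in>S. card {w \<in> S. {u, w} \<in> E} + 2 * r \<le> 2 * t + 4)"
proof (rule disjCI)
  have G: "finite_simple_graph V E" and noK: "\<not> contains_K r V E" using sat by (auto simp: K_saturated_def)
  have finV: "finite V" using G by (simp add: finite_simple_graph_def)
  let ?N = "\<lambda>u. {w \<in> V. {u, w} \<in> E}"
  have low: "card (?N u) \<le> t" "u \<in> V" if "u \<in> S" for u
    using that degree_eq_card_neighbours[OF G, of u] by (auto simp: S_def paired_low_vertices_def)
  assume "\<not> (\<forall>u\<in>S. card {w \<in> S. {u, w} \<in> E} + 2 * r \<le> 2 * t + 4)"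
  then obtain u where u: "u \<in> S" "\<not> card {w \<in> S. {u, w} \<in> E} + 2 * r \<le> 2 * t + 4" by blast
  let ?D = "{w \<in> S. {u, w} \<in> E}"
  let ?F = "{Q. Q \<subseteq> ?N u \<and> clique Q E \<and> card Q = r - 2}"
  have "\<exists>z\<in>?D. V \<subseteq> insert u (?N u \<union> ?N z)"
  proof (rule ccontr)
    assume no: "\<not> (\<exists>z\<in>?D. V \<subseteq> insert u (?N u \<union> ?N z))"
    have avoid: "\<exists>Q\<in>?F. z \<notin> Q" if z: "z \<in> ?D" for z
    proof -
      \<comment> \<open>The clique forced by the missing edge between \<open>u\<close> and
        \<open>x\<close> consists of neighbours of \<open>x\<close>, so it avoids
        \<open>z\<close>.\<close>
      obtain x where x: "x \<in> V" "x \<noteq> u" "{u, x} \<notin> E" "{z, x} \<notin> E" using no z by blast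
      obtain Q where "Q \<subseteq> {q \<in> V. {u, q} \<in> E \<and> {x, q} \<in> E}" "clique Q E" "card Q = r - 2"
        using nonadjacent_common_clique[OF sat low(2)[OF u(1)] x(1) x(2)[symmetric] x(3)] by blast
      then show ?thesis using x(4) by (intro bexI[of _ Q]) (auto simp: insert_commute)
    qed
    obtain w where "w \<in> ?D" using u(1) by (force simp: S_def paired_low_vertices_def insert_commute)
    then have ne: "?F \<noteq> {}" using avoid by blast
    have finN: "finite (?N u)" using finV by simp
    have "2 * (r - 2) \<le> card (\<Inter>?F) + card (\<Union>?F)"
    proof (rule Hajnal_max_cliques[OF _ ne])
      show "finite ?F" using finN by simp
      show "clique_le E (?N u) (r - 2)" using clique_le_neighbourhood[OF G noK low(2)[OF u(1)]] by simp
    qed (use finN finite_subset in auto)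
    moreover have "\<Union>?F \<subseteq> ?N u" by blast
    then have "card (\<Union>?F) \<le> t" using low(1)[OF u(1)] card_mono[OF finN] le_trans by blast
    moreover have "card (\<Inter>?F) + card ?D \<le> t"
    proof -
      have "\<Inter>?F \<subseteq> ?N u" using ne by blast
      moreover have "?D \<subseteq> ?N u" using low(2) by blast
      moreover have "\<Inter>?F \<inter> ?D = {}" using avoid by blast
      ultimately have "card (\<Inter>?F) + card ?D \<le> card (?N u)"
        using finN by (metis (no_types, lifting) Un_least card_Un_disjoint card_mono finite_subset)
      then show ?thesis using low(1)[OF u(1)] by simp
    qed
    ultimately show False using u(2) r by simp
  qed
  then obtain z where z: "z \<in> S" "V \<subseteq> insert u (?N u \<union> ?N z)" by blast
  have "card S \<le> card V" using finV by (intro card_mono) (auto simp: S_def paired_low_vertices_def)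
  also have "\<dots> \<le> card (insert u (?N u \<union> ?N z))" using z(2) finV by (intro card_mono) auto
  also have "\<dots> \<le> Suc (card (?N u \<union> ?N z))" using finV by (simp add: card_insert_if)
  also have "\<dots> \<le> Suc (card (?N u) + card (?N z))" using card_Un_le by auto
  also have "\<dots> \<le> 2 * t + 1" using low(1)[OF u(1)] low(1)[OF z(1)] by simp
  finally show "card S \<le> 2 * t + 1" .
qed

section \<open>Exponential growth of middle binomial coefficients\<close>

lemma central_binomial_odd: "2 * m + 1 choose (m + 1) = (2 * m + 1 choose m)"
  using binomial_symmetric[of "m + 1" "2 * m + 1"] by simp

text \<open>The ratio is \<open>(2 * m + 1) / (m + 1)\<close> from \<open>n = 2 * m\<close> and 2
  from odd \<open>n\<close>. Its minimum over \<open>n \<ge> 1\<close> is \<open>3 / 2\<close>,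
  attained at \<open>n = 2\<close>; this is the origin of the weight base
  \<open>3 / 2\<close>.\<close>

lemma central_binomial_growth_step:
  assumes "n \<ge> 1"
  shows "(3 / 2) * real (n choose (n div 2)) \<le> real (Suc n choose (Suc n div 2))"
proof (cases "even n")
  case True
  then obtain m where m: "n = 2 * m" by blast
  have "(m + 1) * (2 * m + 1 choose m) = (2 * m + 1) * (2 * m choose m)"
    using Suc_times_binomial[of m "2 * m"] central_binomial_odd[of m] by simp
  then have "real ((m + 1) * (2 * m + 1 choose m)) = real ((2 * m + 1) * (2 * m choose m))"
    by (rule arg_cong)
  then have "(real m + 1) * real (2 * m + 1 choose m) = (2 * real m + 1) * real (2 * m choose m)"
    by (simp only: of_nat_mult of_nat_add of_nat_1 of_nat_numeral)
  moreover have "(3 / 2 * (real m + 1)) * real (2 * m choose m) \<le> (2 * real m + 1) * real (2 * m choose m)"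
    using assms m by (intro mult_right_mono) auto
  ultimately have "(real m + 1) * (3 / 2 * real (2 * m choose m)) \<le> (real m + 1) * real (2 * m + 1 choose m)"
    by (simp add: mult_ac)
  then have "3 / 2 * real (2 * m choose m) \<le> real (2 * m + 1 choose m)" by simp
  then show ?thesis by (simp add: m)
next
  case False
  then obtain m where m: "n = 2 * m + 1" by (elim oddE)
  have "2 * m + 2 choose (m + 1) = 2 * (2 * m + 1 choose m)"
    using central_binomial_odd[of m] by simp
  then show ?thesis by (simp add: m)
qed

text \<open>Pass to the middle coefficient and climb to index \<open>2 * s\<close>, gaining
  \<open>3 / 2\<close> per step. The step from 0 to 1 gains nothing, for which the factor
  \<open>3 / 2\<close> on the right compensates.\<close>

lemma binomial_growth:
  assumes "p + q + g \<le> 2 * s"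
  shows "real ((p + q) choose p) * (3 / 2) ^ g \<le> (3 / 2) * real (2 * s choose s)"
proof -
  have step: "(3 / 2) ^ d * real (n choose (n div 2)) \<le> real ((n + d) choose ((n + d) div 2))" if "n \<ge> 1" for n d
  proof (induction d)
    case (Suc d)
    then show ?case using central_binomial_growth_step[of "n + d"] that by simp
  qed simp
  define n where "n = p + q"
  define d where "d = 2 * s - n"
  have nd: "n + d = 2 * s" using assms by (simp add: d_def n_def)
  have "real (n choose p) \<le> real (n choose (n div 2))" by (simp add: binomial_maximum)
  moreover have "(3 / 2 :: real) ^ g \<le> (3 / 2) ^ d" using assms by (intro power_increasing) (auto simp: d_def n_def)
  ultimately have "real (n choose p) * (3 / 2) ^ g \<le> real (n choose (n div 2)) * (3 / 2) ^ d"
    by (intro mult_mono) auto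
  also have "\<dots> \<le> (3 / 2) * real (2 * s choose s)"
  proof (cases "n = 0")
    case False
    then have "real (n choose (n div 2)) * (3 / 2) ^ d \<le> real (2 * s choose s)"
      using step[of n d] nd by (simp add: mult.commute)
    then show ?thesis by simp
  next
    case True
    show ?thesis
    proof (cases s)
      case (Suc m)
      then have "(3 / 2) ^ (d - 1) \<le> real (2 * s choose s)"
        using step[of 1 "d - 1"] True by (simp add: d_def)
      moreover have "(3 / 2 :: real) ^ d = (3 / 2) * (3 / 2) ^ (d - 1)"
        using True Suc by (simp add: d_def power_Suc[symmetric] del: power_Suc)
      ultimately show ?thesis using True by simp
    qed (use True in \<open>simp add: d_def\<close>)
  qed
  finally show ?thesis by (simp add: n_def)
qed

text \<open>Thinning out \<open>A\<close> alone saves the \<open>h\<close> elements, so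
  \<open>B\<close> stays the full neighbourhood of the chosen low neighbour \<open>m u\<close>.
  Random subsets give the first estimate and random orders the second; which is better depends on
  \<open>r\<close> and \<open>s\<close>.\<close>

lemma far_apart_low_vertices_bound:
  fixes V :: "'a::linorder set"
  assumes sat: "K_saturated r V E" and r: "r \<ge> 3" and t: "t + 3 = r + s"
  defines "S \<equiv> paired_low_vertices t V E"
  defines "R \<equiv> \<lambda>x y. {x, y} \<in> E"
  assumes Z: "Z \<subseteq> S" "\<And>x y. x \<in> Z \<Longrightarrow> y \<in> Z \<Longrightarrow> x \<noteq> y \<Longrightarrow> \<not> close R S x y" "card Z \<ge> 2"
  shows "(\<Sum>z\<in>Z. (3 / 2) ^ card (nbrs R S z)) \<le> 2 * (4 :: real) ^ s"
    and "(\<Sum>z\<in>Z. (3 / 2) ^ card (nbrs R S z)) \<le> 3 * real r * real (2 * s choose s)"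
proof -
  have G: "finite_simple_graph V E" and noK: "\<not> contains_K r V E" using sat by (auto simp: K_saturated_def)
  have finV: "finite V" using G by (simp add: finite_simple_graph_def)
  define k where "k = r - 3"
  let ?N = "\<lambda>u. {w \<in> V. {u, w} \<in> E}"
  have low: "card (?N u) \<le> t" "u \<in> V" if "u \<in> S" for u
    using that degree_eq_card_neighbours[OF G, of u] by (auto simp: S_def paired_low_vertices_def)
  have "\<exists>w. w \<in> S \<and> {u, w} \<in> E" if "u \<in> S" for u
    using that unfolding S_def paired_low_vertices_def by (force simp: insert_commute)
  then obtain m where m: "\<And>u. u \<in> S \<Longrightarrow> m u \<in> S \<and> {u, m u} \<in> E" by metis
  define A where "A u = ?N u - S" for u
  define B where "B u = ?N (m u)" for u
  have off: "\<exists>Q\<subseteq>A u \<inter> B u'. clique Q E \<and> card Q = Suc k" if u: "u \<in> Z" "u' \<in> Z" "u \<noteq> u'" for u u'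
  proof -
    have S: "u \<in> S" "u' \<in> S" "m u' \<in> S" "{u', m u'} \<in> E" using u Z(1) m by auto
    have nc: "\<not> close R S u' u" using Z(2) u by blast
    have mu': "m u' \<in> nbrs R S u'" using S by (simp add: nbrs_def R_def)
    have ne: "u \<noteq> m u'" using nc mu' by (auto simp: close_def)
    have nadj: "{u, m u'} \<notin> E"
    proof
      assume "{u, m u'} \<in> E"
      then have "u \<in> nbrs R S (m u')" using S by (simp add: nbrs_def R_def insert_commute)
      then show False using nc mu' unfolding close_def by blast
    qed
    obtain Q where Q: "Q \<subseteq> {q \<in> V. {u, q} \<in> E \<and> {m u', q} \<in> E}" "clique Q E" "card Q = r - 2"
      using nonadjacent_common_clique[OF sat low(2)[OF S(1)] low(2)[OF S(3)] ne nadj] by blast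
    \<comment> \<open>A low common neighbour \<open>z\<close> would complete the walk
      \<open>u'\<close>, \<open>m u'\<close>, \<open>z\<close>, \<open>u\<close> of length
      three.\<close>
    have "z \<notin> S" if "z \<in> Q" for z
    proof
      assume "z \<in> S"
      then have "z \<in> nbrs R S (m u')" "u \<in> nbrs R S z"
        using Q(1) that S(1) by (auto simp: nbrs_def R_def insert_commute)
      then show False using nc mu' unfolding close_def by blast
    qed
    then have "Q \<subseteq> A u \<inter> B u'" using Q(1) by (auto simp: A_def B_def)
    then show ?thesis using Q(2,3) r by (intro exI[of _ Q]) (simp add: k_def)
  qed
  have finZ: "finite Z" using Z(3) by (metis card.infinite not_numeral_le_zero)
  have finAB: "finite (A u)" "finite (B u)" for u using finV by (auto simp: A_def B_def)
  have diag: "clique_le E (A u \<inter> B u) k \<and> k \<le> card (A u) \<and> k \<le> card (B u)" if u: "u \<in> Z" for u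
  proof -
    \<comment> \<open>The lower bounds on \<open>card (A u)\<close> and \<open>card (B u)\<close>
      come from the cliques shared with a second representative, hence
      \<open>card Z \<ge> 2\<close>.\<close>
    have "\<not> Z \<subseteq> {u}" using Z(3) card_mono[of "{u}" Z] by auto
    then obtain u' where u': "u' \<in> Z" "u' \<noteq> u" by blast
    have ge: "k \<le> card X" if "Q \<subseteq> X" "card Q = Suc k" "finite X" for Q X :: "'a set"
      using card_mono[OF that(3,1)] that(2) by simp
    have "k \<le> card (A u)" using off[OF u u'(1)] u'(2) ge[OF _ _ finAB(1)] by (metis le_inf_iff)
    moreover have "k \<le> card (B u)" using off[OF u'(1) u u'(2)] ge[OF _ _ finAB(2)] by (metis le_inf_iff)
    moreover have "clique_le E (A u \<inter> B u) k"
      using clique_le_common_neighbourhood[OF G noK, of u "m u"] m[of u] u Z(1)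
      unfolding k_def by (rule_tac clique_le_mono) (auto simp: A_def B_def)
    ultimately show ?thesis by blast
  qed
  have card_AB: "card (A u) + card (B u) + card (nbrs R S u) \<le> 2 * t" if "u \<in> Z" for u
  proof -
    have u: "u \<in> S" using that Z(1) by blast
    have "nbrs R S u \<subseteq> ?N u" using low(2) by (auto simp: nbrs_def R_def)
    moreover have "A u = ?N u - nbrs R S u" by (auto simp: A_def nbrs_def R_def)
    ultimately have "card (A u) + card (nbrs R S u) = card (?N u)"
      using finV by (simp add: card_Diff_subset card_mono finite_subset)
    then show ?thesis using low(1)[OF u] low(1)[of "m u"] m[OF u] by (simp add: B_def)
  qed
  have ABV: "A u \<subseteq> V \<and> B u \<subseteq> V" for u by (auto simp: A_def B_def)
  obtain p q :: "'a \<Rightarrow> nat" where pq: "\<forall>u\<in>Z. p u + q u + 2 * k \<le> card (A u) + card (B u)"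
    and coins: "(\<Sum>u\<in>Z. 1 / 2 ^ (p u + q u)) \<le> (2::real)"
    and orders: "(\<Sum>u\<in>Z. 1 / real ((p u + q u) choose p u)) \<le> 2 * (real k + 1)"
    using set_pair_inequalities[where I = Z and A = A and B = B, OF finZ finV ABV diag off] by blast
  \<comment> \<open>Here \<open>2 * t - 2 * k = 2 * s\<close>, since \<open>k = r - 3\<close> and
    \<open>t + 3 = r + s\<close>.\<close>
  have pqh: "p u + q u + card (nbrs R S u) \<le> 2 * s" if "u \<in> Z" for u
    using bspec[OF pq that] card_AB[OF that] r t by (simp add: k_def)
  have "(3 / 2) ^ card (nbrs R S u) \<le> 4 ^ s * (1 / 2 ^ (p u + q u) :: real)" if "u \<in> Z" for u
  proof -
    have "(3 / 2 :: real) ^ card (nbrs R S u) * 2 ^ (p u + q u) \<le> 2 ^ card (nbrs R S u) * 2 ^ (p u + q u)"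
      by (intro mult_right_mono power_mono) auto
    also have "\<dots> \<le> 2 ^ (2 * s)"
      unfolding power_add[symmetric] using pqh[OF that] by (intro power_increasing) auto
    also have "\<dots> = 4 ^ s" by (simp add: power_mult)
    finally show ?thesis by (simp add: pos_le_divide_eq)
  qed
  then have "(\<Sum>z\<in>Z. (3 / 2) ^ card (nbrs R S z)) \<le> (\<Sum>u\<in>Z. 4 ^ s * (1 / 2 ^ (p u + q u) :: real))"
    by (rule sum_mono)
  also have "\<dots> \<le> 4 ^ s * 2" unfolding sum_distrib_left[symmetric] using coins by (intro mult_left_mono) auto
  finally show "(\<Sum>z\<in>Z. (3 / 2) ^ card (nbrs R S z)) \<le> 2 * (4 :: real) ^ s" by simp
  let ?c = "(3 / 2) * real (2 * s choose s)"
  have "(3 / 2) ^ card (nbrs R S u) \<le> ?c * (1 / real ((p u + q u) choose p u))" if "u \<in> Z" for u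
    using binomial_growth[OF pqh[OF that]] by (simp add: field_simps)
  then have "(\<Sum>z\<in>Z. (3 / 2) ^ card (nbrs R S z)) \<le> (\<Sum>u\<in>Z. ?c * (1 / real ((p u + q u) choose p u)))"
    by (rule sum_mono)
  also have "\<dots> \<le> ?c * (2 * (real k + 1))"
    unfolding sum_distrib_left[symmetric] using orders by (intro mult_left_mono) auto
  also have "\<dots> \<le> ?c * (2 * real r)" using r by (intro mult_left_mono) (auto simp: k_def)
  finally show "(\<Sum>z\<in>Z. (3 / 2) ^ card (nbrs R S z)) \<le> 3 * real r * real (2 * s choose s)"
    by (simp add: mult_ac)
qed

section \<open>The order of magnitude\<close>

lemma central_binomial_Suc:
  "(real s + 1) * real (2 * Suc s choose Suc s) = 2 * (2 * real s + 1) * real (2 * s choose s)"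
proof -
  have odd: "(s + 1) * (2 * s + 1 choose s) = (2 * s + 1) * (2 * s choose s)"
    using Suc_times_binomial[of s "2 * s"] central_binomial_odd[of s] by simp
  have even: "2 * Suc s choose Suc s = 2 * (2 * s + 1 choose s)"
    using central_binomial_odd[of s] by simp
  have "(s + 1) * (2 * Suc s choose Suc s) = 2 * ((s + 1) * (2 * s + 1 choose s))"
    unfolding even by (rule mult.left_commute)
  also have "\<dots> = 2 * (2 * s + 1) * (2 * s choose s)" unfolding odd by (simp only: mult.assoc)
  finally have "real ((s + 1) * (2 * Suc s choose Suc s)) = real (2 * (2 * s + 1) * (2 * s choose s))"
    by (rule arg_cong)
  then show ?thesis by (simp only: of_nat_mult of_nat_add of_nat_1 of_nat_numeral)
qed

text \<open>Squares keep the induction free of roots; the step rests on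
  \<open>(2 * x + 3) * (2 * x + 1) \<le> 4 * (x + 1) ^ 2\<close>.\<close>

lemma central_binomial_square_upper: "(2 * real s + 1) * real (2 * s choose s) ^ 2 \<le> 16 ^ s"
proof (induction s)
  case (Suc s)
  define x c d where "x = real s" and "c = real (2 * s choose s)" and "d = real (2 * Suc s choose Suc s)"
  have x: "x \<ge> 0" and IH: "(2 * x + 1) * c ^ 2 \<le> 16 ^ s" and rec: "(x + 1) * d = 2 * (2 * x + 1) * c"
    using Suc central_binomial_Suc[of s] by (simp_all only: x_def c_def d_def of_nat_0_le_iff)
  have "(x + 1) ^ 2 * ((2 * x + 3) * d ^ 2) = (2 * x + 3) * ((x + 1) * d) ^ 2"
    by (simp add: power_mult_distrib)
  also have "\<dots> = 4 * ((2 * x + 3) * (2 * x + 1)) * ((2 * x + 1) * c ^ 2)"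
    unfolding rec by (simp add: power2_eq_square algebra_simps)
  also have "\<dots> \<le> 4 * (4 * (x + 1) ^ 2) * 16 ^ s"
  proof (rule mult_mono)
    show "4 * ((2 * x + 3) * (2 * x + 1)) \<le> 4 * (4 * (x + 1) ^ 2)"
      by (simp add: power2_eq_square algebra_simps)
  qed (use IH x in simp_all)
  also have "\<dots> = (x + 1) ^ 2 * 16 ^ Suc s" by simp
  finally have "(2 * x + 3) * d ^ 2 \<le> 16 ^ Suc s"
    by (rule mult_left_le_imp_le) (use x in simp)
  moreover have "2 * real (Suc s) + 1 = 2 * x + 3" by (simp add: x_def)
  ultimately show ?case unfolding d_def by (simp only:)
qed simp

text \<open>Equality holds at \<open>s = 1\<close>, and the step rests on
  \<open>4 * (x * (x + 1)) \<le> (2 * x + 1) ^ 2\<close>.\<close>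

lemma central_binomial_square_lower: "s \<ge> 1 \<Longrightarrow> 16 ^ s \<le> 4 * (real s * real (2 * s choose s) ^ 2)"
proof (induction s rule: dec_induct)
  case base
  then show ?case by (simp add: power2_eq_square)
next
  case (step s)
  define x c d where "x = real s" and "c = real (2 * s choose s)" and "d = real (2 * Suc s choose Suc s)"
  have IH: "16 ^ s \<le> 4 * (x * c ^ 2)" and rec: "(x + 1) * d = 2 * (2 * x + 1) * c"
    using step.IH central_binomial_Suc[of s] by (simp_all only: x_def c_def d_def)
  have x: "x > 0" using step.hyps by (simp add: x_def)
  have "(x * (x + 1)) * 16 ^ Suc s = 16 * (x * (x + 1)) * 16 ^ s" by simp
  also have "\<dots> \<le> 16 * (x * (x + 1)) * (4 * (x * c ^ 2))"
    using IH x by (intro mult_left_mono) auto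
  also have "\<dots> = 16 * (4 * (x * (x + 1))) * (x * c ^ 2)" by simp
  also have "\<dots> \<le> 16 * ((2 * x + 1) ^ 2) * (x * c ^ 2)"
  proof (rule mult_right_mono)
    show "16 * (4 * (x * (x + 1))) \<le> 16 * ((2 * x + 1) ^ 2)" by (simp add: power2_eq_square algebra_simps)
  qed (use x in simp)
  also have "\<dots> = 4 * x * (2 * (2 * x + 1) * c) ^ 2" by (simp only: power_mult_distrib) simp
  also have "\<dots> = (x * (x + 1)) * (4 * ((x + 1) * d ^ 2))"
    unfolding rec[symmetric] by (simp add: power2_eq_square)
  finally have "16 ^ Suc s \<le> 4 * ((x + 1) * d ^ 2)"
    by (rule mult_left_le_imp_le) (use x in simp)
  moreover have "real (Suc s) = x + 1" by (simp add: x_def)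
  ultimately show ?case unfolding d_def by (simp only:)
qed

lemma sixteen_power: "(16 :: real) ^ s = (4 ^ s) ^ 2"
  by (simp add: power2_eq_square power_mult_distrib[symmetric])

lemma central_binomial_upper:
  assumes "s \<ge> 1"
  shows "real (2 * s choose s) \<le> 4 ^ s / sqrt (real s)"
proof -
  have "(sqrt (real s) * real (2 * s choose s)) ^ 2 = real s * real (2 * s choose s) ^ 2"
    by (simp add: power_mult_distrib)
  also have "\<dots> \<le> (2 * real s + 1) * real (2 * s choose s) ^ 2" by (intro mult_right_mono) auto
  also have "\<dots> \<le> (4 ^ s) ^ 2" using central_binomial_square_upper[of s] unfolding sixteen_power .
  finally have "sqrt (real s) * real (2 * s choose s) \<le> 4 ^ s" by (rule power2_le_imp_le) simp
  then show ?thesis using assms by (simp add: pos_le_divide_eq mult.commute)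
qed

lemma central_binomial_lower:
  assumes "s \<ge> 1"
  shows "4 ^ s / (2 * sqrt (real s)) \<le> real (2 * s choose s)"
proof -
  have "(4 ^ s) ^ 2 = (16 :: real) ^ s" by (rule sixteen_power[symmetric])
  also have "\<dots> \<le> (2 * sqrt (real s) * real (2 * s choose s)) ^ 2"
    using central_binomial_square_lower[OF assms] by (simp add: power_mult_distrib)
  finally have "4 ^ s \<le> 2 * sqrt (real s) * real (2 * s choose s)" by (rule power2_le_imp_le) simp
  then show ?thesis using assms by (simp add: pos_divide_le_eq mult_ac)
qed

text \<open>Absorbs the degenerate cases into the main term: \<open>s\<close> arises when there are
  at most \<open>2 * t + 1\<close> low vertices, and \<open>((3 / 2) ^ 2) ^ s\<close> from a single
  representative of degree at most \<open>2 * s\<close>.\<close>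

lemma main_term_lower:
  assumes "s \<ge> 1" "x \<ge> (1 :: real)"
  defines "M \<equiv> 4 ^ s * min x (sqrt (real s)) / sqrt (real s)"
  shows "real s \<le> M" and "((3 / 2) ^ 2) ^ s \<le> M"
proof -
  have s2: "real s \<le> 2 ^ s" using of_nat_less_two_power[of s, where 'a = real] by simp
  have pos: "sqrt (real s) > 0" using assms by simp
  have "1 \<le> min x (sqrt (real s))" using assms by simp
  then have M: "4 ^ s / sqrt (real s) \<le> M"
    unfolding M_def using pos by (intro divide_right_mono) auto
  have "sqrt (real s) \<le> real s"
    using assms(1) by (intro real_le_lsqrt) (auto simp: power2_eq_square)
  then have "sqrt (real s) \<le> 2 ^ s" using s2 by linarith
  then have "real s * sqrt (real s) \<le> 2 ^ s * 2 ^ s" using s2 by (intro mult_mono) auto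
  also have "\<dots> = (4 :: real) ^ s" by (simp add: power_mult_distrib[symmetric])
  finally show "real s \<le> M" using M pos by (simp add: pos_le_divide_eq) (meson pos pos_le_divide_eq order_trans)
  \<comment> \<open>\<open>16 / 9\<close> is the quotient of 4 by \<open>(3 / 2) ^ 2\<close>, and
    its square \<open>256 / 81\<close> exceeds 2.\<close>
  have "real s \<le> ((16 / 9) ^ s) ^ 2"
  proof -
    have "(2 :: real) ^ s \<le> (256 / 81) ^ s" by (intro power_mono) auto
    also have "\<dots> = ((16 / 9) ^ s) ^ 2" by (simp add: power2_eq_square power_mult_distrib[symmetric])
    finally show ?thesis using s2 by linarith
  qed
  then have "sqrt (real s) \<le> (16 / 9) ^ s" by (intro real_le_lsqrt) auto
  then have "((3 / 2) ^ 2) ^ s * sqrt (real s) \<le> ((3 / 2) ^ 2) ^ s * (16 / 9 :: real) ^ s"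
    by (intro mult_left_mono) auto
  also have "\<dots> = 4 ^ s" by (simp add: power_mult_distrib[symmetric] power2_eq_square)
  finally have "((3 / 2) ^ 2) ^ s \<le> 4 ^ s / sqrt (real s)" using pos by (simp add: pos_le_divide_eq)
  then show "((3 / 2) ^ 2) ^ s \<le> M" using M by simp
qed

text \<open>The exponent is real because \<open>t - r\<close> may be negative;
  \<open>64 = 4 ^ 3\<close> reflects the shift from \<open>t - r\<close> to
  \<open>s\<close>.\<close>

lemma powr_shift:
  assumes "r \<le> t + 3"
  shows "4 powr (real t - real r) = 4 ^ (t + 3 - r) / 64"
proof -
  have "real t - real r = real (t + 3 - r) - 3" using assms by simp
  then show ?thesis by (simp add: powr_diff powr_realpow del: of_nat_diff)
qed

lemma paired_low_vertices_upper_bound: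
  obtains C :: real where "C > 0"
    "\<And>r t (V :: nat set) E. r \<ge> 3 \<Longrightarrow> t \<ge> r - 2 \<Longrightarrow> K_saturated r V E \<Longrightarrow>
      real (card (paired_low_vertices t V E)) \<le>
        C * (4 powr (real t - real r) * min (real r) (sqrt (real t - real r + 3)) / sqrt (real t - real r + 3) + real r)"
proof -
  obtain C :: real where C: "C > 0" "\<And>(S :: nat set) R. finite S \<Longrightarrow> symp R \<Longrightarrow> (\<forall>v\<in>S. nbrs R S v \<noteq> {}) \<Longrightarrow>
     \<exists>Z\<subseteq>S. (\<forall>x\<in>Z. \<forall>y\<in>Z. x \<noteq> y \<longrightarrow> \<not> close R S x y) \<and>
        real (card S) \<le> C * (\<Sum>z\<in>Z. (3 / 2) ^ card (nbrs R S z))"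
    using exists_far_apart_representatives[where 'a = nat] by metis
  show thesis
  \<comment> \<open>\<open>M / 64\<close> is the main term of the claim, so a bound
    \<open>3 * C * M\<close> costs \<open>192 * C\<close>, and the bound
    \<open>2 * s + 2 * r\<close> of the small case costs 128.\<close>
  proof (rule that[of "192 * C + 128"])
    show "192 * C + 128 > 0" using C(1) by simp
    fix r t :: nat and V :: "nat set" and E
    assume r: "r \<ge> 3" and t: "t \<ge> r - 2" and sat: "K_saturated r V E"
    define S where "S = paired_low_vertices t V E"
    define s where "s = t + 3 - r"
    define R where "R = (\<lambda>x y :: nat. {x, y} \<in> E)"
    define M where "M = 4 ^ s * min (real r) (sqrt (real s)) / sqrt (real s)"
    have s: "s \<ge> 1" "t + 3 = r + s" using r t by (auto simp: s_def)
    have G: "finite V" using sat by (simp add: K_saturated_def finite_simple_graph_def)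
    have finS: "finite S" using G by (simp add: S_def paired_low_vertices_def)
    have "symp R" by (auto simp: R_def symp_def insert_commute)
    moreover have "\<forall>v\<in>S. nbrs R S v \<noteq> {}"
      unfolding S_def R_def nbrs_def paired_low_vertices_def by (fastforce simp: insert_commute)
    ultimately obtain Z where Z: "Z \<subseteq> S" "\<forall>x\<in>Z. \<forall>y\<in>Z. x \<noteq> y \<longrightarrow> \<not> close R S x y"
        "real (card S) \<le> C * (\<Sum>z\<in>Z. (3 / 2) ^ card (nbrs R S z))"
      using C(2)[OF finS, of R] by blast
    have M: "real s \<le> M" "((3 / 2) ^ 2) ^ s \<le> M"
      using main_term_lower[OF s(1), of "real r"] r by (auto simp: M_def)
    have M0: "M \<ge> 0" using M(1) by linarith
    have bound: "real (card S) \<le> (192 * C + 128) * (M / 64 + real r)"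
    proof (cases "card Z \<ge> 2")
      case True
      have *: "\<not> close R S x y" if "x \<in> Z" "y \<in> Z" "x \<noteq> y" for x y using Z(2) that by blast
      let ?sum = "\<Sum>z\<in>Z. (3 / 2 :: real) ^ card (nbrs R S z)"
      have b: "?sum \<le> 2 * 4 ^ s" "?sum \<le> 3 * real r * real (2 * s choose s)"
        using far_apart_low_vertices_bound[OF sat r s(2), of Z] Z(1) * True unfolding S_def R_def by blast+
      have "?sum \<le> 3 * M"
      \<comment> \<open>The minimum in \<open>M\<close> is decided here: random orders are used when
        \<open>r\<close> is at most the root of \<open>s\<close>, random subsets otherwise.\<close>
      proof (cases "real r \<le> sqrt (real s)")
        case True
        have "?sum \<le> 3 * real r * (4 ^ s / sqrt (real s))"
          using b(2) mult_left_mono[OF central_binomial_upper[OF s(1)], of "3 * real r"] by simp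
        then show ?thesis using True by (simp add: M_def mult_ac)
      next
        case False
        then have "M = 4 ^ s" using s(1) by (simp add: M_def)
        then show ?thesis using b(1) M0 by linarith
      qed
      then have "C * ?sum \<le> C * (3 * M)" using C(1) by (intro mult_left_mono) auto
      then have "real (card S) \<le> C * (3 * M)" using Z(3) by linarith
      also have "\<dots> \<le> (192 * C + 128) * (M / 64 + real r)" using C(1) M0 by (simp add: algebra_simps)
      finally show ?thesis .
    next
      case False
      \<comment> \<open>\<open>Z\<close> has at most one element, so unless \<open>S\<close> itself
        is small it suffices to bound a single weight.\<close>
      consider "card S \<le> 2 * t + 1" | "\<forall>u\<in>S. card {w \<in> S. {u, w} \<in> E} + 2 * r \<le> 2 * t + 4"
        using few_low_vertices_or_small_degree[OF sat r, of t] unfolding S_def by blast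
      then show ?thesis
      proof cases
        case 1
        then have "real (card S) \<le> 2 * real s + 2 * real r" using s(2) by linarith
        also have "\<dots> \<le> 2 * M + 128 * real r" using M(1) by simp
        also have "\<dots> \<le> (192 * C + 128) * (M / 64 + real r)" using C(1) M0 by (simp add: algebra_simps)
        finally show ?thesis .
      next
        case 2
        have "(\<Sum>z\<in>Z. (3 / 2 :: real) ^ card (nbrs R S z)) \<le> (\<Sum>z\<in>Z. ((3 / 2) ^ 2) ^ s)"
        proof (rule sum_mono)
          fix z assume "z \<in> Z"
          then have "card (nbrs R S z) + 2 * r \<le> 2 * t + 4" using 2 Z(1) by (auto simp: nbrs_def R_def)
          then have "card (nbrs R S z) \<le> 2 * s" using s(2) by linarith
          then have "(3 / 2 :: real) ^ card (nbrs R S z) \<le> (3 / 2) ^ (2 * s)" by (intro power_increasing) auto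
          then show "(3 / 2 :: real) ^ card (nbrs R S z) \<le> ((3 / 2) ^ 2) ^ s" by (simp only: power_mult)
        qed
        also have "\<dots> = real (card Z) * ((3 / 2) ^ 2) ^ s" by simp
        also have "\<dots> \<le> 1 * M" using M False M0 by (intro mult_mono) auto
        finally have "C * (\<Sum>z\<in>Z. (3 / 2 :: real) ^ card (nbrs R S z)) \<le> C * M"
          using C(1) by (intro mult_left_mono) auto
        then have "real (card S) \<le> C * M" using Z(3) by linarith
        also have "\<dots> \<le> (192 * C + 128) * (M / 64 + real r)" using C(1) M0 by (simp add: algebra_simps)
        finally show ?thesis .
      qed
    qed
    have shift: "real t - real r + 3 = real s" using s(2) by linarith
    have powr: "4 powr (real t - real r) = 4 ^ s / 64" unfolding s_def using r t by (intro powr_shift) simp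
    show "real (card (paired_low_vertices t V E)) \<le> (192 * C + 128) *
        (4 powr (real t - real r) * min (real r) (sqrt (real t - real r + 3)) / sqrt (real t - real r + 3) + real r)"
      unfolding shift powr using bound by (simp add: M_def S_def mult.commute)
  qed
qed

lemma low_max_lower_bound:
  assumes r: "r \<ge> 3" and t: "t \<ge> r - 2" and fin: "finite (low_counts r t)"
  shows "2 / 5 * (4 powr (real t - real r) / sqrt (real t - real r + 3) + real r) \<le> real (low_max r t)"
proof -
  define s where "s = t + 3 - r"
  have s: "s \<ge> 1" "t + 3 = r + s" using r t by (auto simp: s_def)
  have "r - 1 \<le> low_max r t"
    unfolding low_max_def using low_counts_complete[OF r t] fin by (rule Max_ge[rotated])
  \<comment> \<open>\<open>r \<ge> 3\<close> gives \<open>r \<le> 3 / 2 * (r - 1)\<close>. The main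
    term adds at most one more copy of the maximum, so the total is \<open>5 / 2\<close> and the
    constant \<open>2 / 5\<close>.\<close>
  then have r1: "real r \<le> 3 / 2 * real (low_max r t)" using r by linarith
  have "4 ^ s / (64 * sqrt (real s)) \<le> real (low_max r t)"
  \<comment> \<open>The construction has \<open>m = s - 1\<close> and needs
    \<open>m \<ge> 2\<close>; for \<open>s = 1\<close> and \<open>s = 2\<close> the main term is at
    most 1.\<close>
  proof (cases "s \<ge> 3")
    case True
    define m where "m = s - 1"
    have m: "m \<ge> 2" "s = m + 1" using True by (auto simp: m_def)
    have "3 + (r - 3) = r" "m + 1 + (r - 3) = t" using r s(2) m by auto
    then obtain n where n: "n \<in> low_counts r t" "2 * m choose m \<le> n"
      using low_counts_central_binomial[OF m(1), of "r - 3"] by metis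
    have "sqrt (real m) \<le> sqrt (real s)" using m by simp
    moreover have "0 < sqrt (real m)" using m by simp
    ultimately have "2 * sqrt (real m) \<le> 16 * sqrt (real s)" by linarith
    then have "4 ^ m / (16 * sqrt (real s)) \<le> 4 ^ m / (2 * sqrt (real m))"
      using m by (intro frac_le) auto
    then have "4 ^ s / (64 * sqrt (real s)) \<le> 4 ^ m / (2 * sqrt (real m))" by (simp add: m(2))
    also have "\<dots> \<le> real (2 * m choose m)" using m by (intro central_binomial_lower) auto
    also have "\<dots> \<le> real n" using n by simp
    also have "\<dots> \<le> real (low_max r t)" unfolding low_max_def using n(1) fin by simp
    finally show ?thesis .
  next
    case False
    then have "s = 1 \<or> s = 2" using s by auto
    then have "(4 :: real) ^ s \<le> 64" by auto
    moreover have "1 \<le> sqrt (real s)" using s(1) by simp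
    ultimately have "4 ^ s \<le> 64 * sqrt (real s)" by linarith
    then have "4 ^ s / (64 * sqrt (real s)) \<le> (1 :: real)" using s(1) by (simp add: divide_le_eq)
    then show ?thesis using r1 r by linarith
  qed
  then have bound: "4 ^ s / (64 * sqrt (real s)) + real r \<le> 5 / 2 * real (low_max r t)" using r1 by linarith
  have shift: "real t - real r + 3 = real s" using s(2) by linarith
  have powr: "4 powr (real t - real r) = 4 ^ s / 64" unfolding s_def using r t by (intro powr_shift) simp
  show ?thesis unfolding shift powr using bound by simp
qed

theorem theorem3:
  shows "\<exists>C1 C2 :: real. C1 > 0 \<and> C2 > 0 \<and>
    (\<forall>r t :: nat. r \<ge> 3 \<and> t \<ge> r - 2 \<longrightarrow>
       finite (low_counts r t) \<and>
       C1 * (4 powr (real t - real r) / sqrt (real t - real r + 3) + real r) \<le> real (low_max r t) \<and>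
       real (low_max r t) \<le>
         C2 * (4 powr (real t - real r) * min (real r) (sqrt (real t - real r + 3))
                 / sqrt (real t - real r + 3) + real r))"
proof -
  obtain C :: real where C: "C > 0" and upper:
    "\<And>r t (V :: nat set) E. r \<ge> 3 \<Longrightarrow> t \<ge> r - 2 \<Longrightarrow> K_saturated r V E \<Longrightarrow>
      real (card (paired_low_vertices t V E)) \<le>
        C * (4 powr (real t - real r) * min (real r) (sqrt (real t - real r + 3)) / sqrt (real t - real r + 3) + real r)"
    using paired_low_vertices_upper_bound by blast
  have "finite (low_counts r t) \<and>
       2 / 5 * (4 powr (real t - real r) / sqrt (real t - real r + 3) + real r) \<le> real (low_max r t) \<and>
       real (low_max r t) \<le>
         C * (4 powr (real t - real r) * min (real r) (sqrt (real t - real r + 3))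
                 / sqrt (real t - real r + 3) + real r)" (is "_ \<and> _ \<and> _ \<le> ?B")
    if rt: "r \<ge> 3" "t \<ge> r - 2" for r t
  proof -
    have le: "real n \<le> ?B" if "n \<in> low_counts r t" for n
      using that upper[OF rt] by (auto simp: low_counts_def)
    then have "low_counts r t \<subseteq> {..nat \<lfloor>?B\<rfloor>}" by (auto simp: le_nat_floor)
    then have fin: "finite (low_counts r t)" by (rule finite_subset) simp
    have "low_max r t \<in> low_counts r t"
      unfolding low_max_def using fin low_counts_complete[OF rt] by (intro Max_in) auto
    then show ?thesis using le low_max_lower_bound[OF rt fin] fin by blast
  qed
  then show ?thesis using C by (intro exI[of _ "2 / 5"] exI[of _ C]) auto
qed

end
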